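(* Let $\epsilon$ be an integer, let $V$ be a vertex algebra and let $(W,Y_W)$ be a $\phi_\epsilon$-coordinated $V$-module. Then for all $u,v\in V$, $$(x_2z)^{-1}\delta\left(\frac{x_1-x_2}{x_2z}\right)Y_W(u,x_1)Y_W(v,x_2)-(x_2z)^{-1}\delta\left(\frac{x_2-x_1}{-x_2z}\right)Y_W(v,x_2)Y_W(u,x_1)$$ $$=x_1^{-1}\delta\left(\frac{x_2(1+z)}{x_1}\right)Y_W\left(Y(u,f_\epsilon(x_2,z))v,x_2\right),$$ where $f_\epsilon(x,z)=x^{1-\epsilon}\cdot\frac{(1+z)^{1-\epsilon}-1}{1-\epsilon}$ if $\epsilon\ne1$ and $f_1(x,z)=\log(1+z)$. Furthermore, for all $u,v\in V$, $$[Y_W(u,x_1),Y_W(v,x_2)]=\sum_{j\ge0}\frac{1}{j!}\left[\left(x_2^\epsilon\frac{\partial}{\partial x_2}\right)^jx_1^{\epsilon-1}\delta\left(\frac{x_2}{x_1}\right)\right]Y_W(u_jv,x_2).$$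
   Context: All vector spaces are over $\mathbb{C}$; $x,z,x_0,x_1,x_2$ are formal variables; $W((x_1,x_2))=W[[x_1,x_2]][x_1^{-1},x_2^{-1}]$. Formal delta function: $\delta(x)=\sum_{n\in\mathbb{Z}}x^n$. Convention: $(x_1-x_2)^n$ for $n\in\mathbb{Z}$ is expanded in nonnegative powers of the second variable $x_2$ (and $(x_2-x_1)^n$ in nonnegative powers of $x_1$), $(1+z)^n$ in nonnegative powers of $z$. Since $f_\epsilon(x_2,z)$ is $z$ times a unit of $\mathbb{C}((x_2))[[z]]$, all its integer powers are understood in $\mathbb{C}((x_2))((z))$. For an integer $\epsilon$ set $\phi_\epsilon(x,z)=e^{z(x^\epsilon d/dx)}x=\sum_{n\ge0}\frac{z^n}{n!}\left(x^\epsilon\frac{d}{dx}\right)^nx\in\mathbb{C}((x))[[z]]$. For $F(x_1,x_2)\in\mathrm{Hom}(W,W((x_1,x_2)))$, the substitution $F|_{x_1=\phi_\epsilon(x_2,x_0)}$ is obtained by replacing each $x_1^m$ ($m\in\mathbb{Z}$) by $\phi_\epsilon(x_2,x_0)^m=e^{x_0x_2^\epsilon\partial/\partial x_2}x_2^m\in\mathbb{C}((x_2))[[x_0]]$. Vertex algebra: a vector space $V$ with a linear map $Y(\cdot,x):V\to\mathrm{Hom}(V,V((x)))$, $Y(v,x)=\sum_{n\in\mathbb{Z}}v_nx^{-n-1}$ (so $u_jv$ denotes the $j$-th product), and a vector $\mathbf 1\in V$ such that $Y(\mathbf 1,x)=1$, $Y(v,x)\mathbf 1\in V[[x]]$ with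 $\lim_{x\to0}Y(v,x)\mathbf 1=v$; for all $u,v,w\in V$ there is $l\ge0$ with $(x_0+x_2)^lY(u,x_0+x_2)Y(v,x_2)w=(x_0+x_2)^lY(Y(u,x_0)v,x_2)w$; and for all $u,v\in V$ there is $k\ge0$ with $(x_1-x_2)^kY(u,x_1)Y(v,x_2)=(x_1-x_2)^kY(v,x_2)Y(u,x_1)$. $\phi_\epsilon$-coordinated $V$-module: a vector space $W$ with a linear map $Y_W(\cdot,x):V\to\mathrm{Hom}(W,W((x)))$ such that $Y_W(\mathbf 1,x)=1_W$ and for all $u,v\in V$ there is an integer $k\ge0$ with $(x_1-x_2)^kY_W(u,x_1)Y_W(v,x_2)\in\mathrm{Hom}(W,W((x_1,x_2)))$ and $(\phi_\epsilon(x_2,x_0)-x_2)^kY_W(Y(u,x_0)v,x_2)=\left((x_1-x_2)^kY_W(u,x_1)Y_W(v,x_2)\right)|_{x_1=\phi_\epsilon(x_2,x_0)}$. *)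

theory Defs
  imports
    Complex_Main
    "HOL-Library.Groups_Big_Fun"
    "HOL-Library.Product_Plus"
    "HOL-Computational_Algebra.Formal_Laurent_Series"
begin

section \<open>Formal series infinite in both directions\<close>

text \<open>
  A formal series with coefficients in \<open>'a\<close> is the function of its coefficients, indexed by the
  exponents: \<open>int \<Rightarrow> 'a\<close> in one variable, \<open>int \<times> int \<Rightarrow> 'a\<close> in two, \<open>int \<times> int \<times> int \<Rightarrow> 'a\<close> in three.

  Products and substitutions use \<^const>\<open>Sum_any\<close>, the sum over the support, whose value is 0 when
  the support is infinite. They are only applied where every coefficient is a sum with finite support.
\<close>

definition fmonom :: "'i \<Rightarrow> 'a \<Rightarrow> 'i \<Rightarrow> 'a::zero"
  where "fmonom i c = (\<lambda>j. if j = i then c else 0)"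

definition fmul :: "('c::zero \<Rightarrow> 'a \<Rightarrow> 'a::comm_monoid_add) \<Rightarrow> ('i::ab_group_add \<Rightarrow> 'c) \<Rightarrow> ('i \<Rightarrow> 'a) \<Rightarrow> 'i \<Rightarrow> 'a"
  where "fmul s f g = (\<lambda>k. Sum_any (\<lambda>i. s (f i) (g (k - i))))"

text \<open>\<open>\<delta>(A)\<close>, where \<open>p n\<close> is the expansion of \<open>A\<^sup>n\<close>.\<close>

definition fdelta :: "(int \<Rightarrow> 'i \<Rightarrow> complex) \<Rightarrow> 'i \<Rightarrow> complex"
  where "fdelta p = (\<lambda>i. Sum_any (\<lambda>n. p n i))"

text \<open>\<open>(x + c y)\<^sup>n\<close> expanded in nonnegative powers of \<open>y\<close>, with exponents listed in the order \<open>(x, y)\<close>.\<close>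

definition binom_pow :: "complex \<Rightarrow> int \<Rightarrow> int \<times> int \<Rightarrow> complex"
  where "binom_pow c n = (\<lambda>(a, b). if 0 \<le> b \<and> a + b = n then (of_int n gchoose nat b) * c ^ nat b else 0)"

definition laurent1 :: "(int \<Rightarrow> 'a::zero) \<Rightarrow> bool"
  where "laurent1 f \<longleftrightarrow> (\<exists>N. \<forall>n<N. f n = 0)"

definition laurent2 :: "(int \<times> int \<Rightarrow> 'a::zero) \<Rightarrow> bool"
  where "laurent2 f \<longleftrightarrow> (\<exists>N. \<forall>m n. m < N \<or> n < N \<longrightarrow> f (m, n) = 0)"

text \<open>
  Operator-valued series: \<open>F w\<close> is the series obtained by applying \<open>F\<close> to the vector \<open>w\<close>, so
  \<open>Hom(W, W((x)))\<close> is \<open>in_Hom s laurent1\<close> and \<open>Hom(W, W((x\<^sub>1, x\<^sub>2)))\<close> is \<open>in_Hom s laurent2\<close>.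
\<close>

definition in_Hom :: "(complex \<Rightarrow> 'w \<Rightarrow> 'w::ab_group_add) \<Rightarrow> (('i \<Rightarrow> 'w) \<Rightarrow> bool) \<Rightarrow> ('w \<Rightarrow> 'i \<Rightarrow> 'w) \<Rightarrow> bool"
  where "in_Hom s P F \<longleftrightarrow> (\<forall>i. Vector_Spaces.linear s s (\<lambda>w. F w i)) \<and> (\<forall>w. P (F w))"

text \<open>
  An element of \<open>\<complex>((x))((z))\<close> is a \<^typ>\<open>complex fls fls\<close> whose outer variable is \<open>z\<close>. The exponents
  of its series are listed in the order \<open>(z, x)\<close>.
\<close>

definition ser2 :: "complex fls fls \<Rightarrow> int \<times> int \<Rightarrow> complex"
  where "ser2 h = (\<lambda>(c, b). fls_nth (fls_nth h c) b)"

text \<open>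
  For a series \<open>F\<close> in \<open>(x\<^sub>1, x\<^sub>2)\<close> and series \<open>p m\<close> in \<open>(z, x\<^sub>2)\<close>, the series in \<open>(z, x\<^sub>2)\<close> obtained from
  \<open>F\<close> by replacing each \<open>x\<^sub>1\<^sup>m\<close> by \<open>p m\<close>.
\<close>

definition fsubst :: "(complex \<Rightarrow> 'w \<Rightarrow> 'w::comm_monoid_add) \<Rightarrow> (int \<Rightarrow> int \<times> int \<Rightarrow> complex)
    \<Rightarrow> (int \<times> int \<Rightarrow> 'w) \<Rightarrow> int \<times> int \<Rightarrow> 'w"
  where "fsubst s p F = (\<lambda>(c, b). Sum_any (\<lambda>(m, n). s (p m (c, b - n)) (F (m, n))))"

text \<open>
  The product \<open>Y(u, x\<^sub>1) Y(v, x\<^sub>2) w\<close> in \<open>(x\<^sub>1, x\<^sub>2)\<close>, and the iterate \<open>Y\<^sub>W(Y(u, x\<^sub>0) v, x\<^sub>2) w\<close> in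
  \<open>(x\<^sub>0, x\<^sub>2)\<close>. Here and below \<open>Y u v n\<close> is the coefficient of \<open>x\<^sup>n\<close> in \<open>Y(u, x) v\<close>.
\<close>

definition Yprod :: "('v \<Rightarrow> 'w \<Rightarrow> int \<Rightarrow> 'w) \<Rightarrow> 'v \<Rightarrow> 'v \<Rightarrow> 'w \<Rightarrow> int \<times> int \<Rightarrow> 'w"
  where "Yprod Y u v w = (\<lambda>(a, b). Y u (Y v w b) a)"

definition Yiter :: "('v \<Rightarrow> 'v \<Rightarrow> int \<Rightarrow> 'v) \<Rightarrow> ('v \<Rightarrow> 'w \<Rightarrow> int \<Rightarrow> 'w) \<Rightarrow> 'v \<Rightarrow> 'v \<Rightarrow> 'w \<Rightarrow> int \<times> int \<Rightarrow> 'w"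
  where "Yiter Y YW u v w = (\<lambda>(a, b). YW (Y u v a) w b)"

text \<open>The \<open>j\<close>-th product \<open>u\<^sub>j v\<close>, where \<open>Y(u, x) = \<Sum> u\<^sub>j x\<^bsup>-j-1\<^esup>\<close>.\<close>

definition mode :: "('v \<Rightarrow> 'v \<Rightarrow> int \<Rightarrow> 'v) \<Rightarrow> 'v \<Rightarrow> int \<Rightarrow> 'v \<Rightarrow> 'v"
  where "mode Y u j v = Y u v (- j - 1)"


section \<open>Vertex algebras\<close>

locale vertex_algebra = vector_space sV
  for sV :: "complex \<Rightarrow> 'v \<Rightarrow> 'v::ab_group_add" +
  fixes Y :: "'v \<Rightarrow> 'v \<Rightarrow> int \<Rightarrow> 'v"
    and vac :: 'v
  assumes Y_linear: "\<And>v n. Vector_Spaces.linear sV sV (\<lambda>u. Y u v n)"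
    and Y_Hom: "\<And>u. in_Hom sV laurent1 (Y u)"
    and vacuum: "\<And>v. Y vac v = fmonom 0 v"
    and creation_regular: "\<And>v n. n < 0 \<Longrightarrow> Y v vac n = 0"
    and creation_limit: "\<And>v. Y v vac 0 = v"
    and weak_associativity: "\<And>u v w. \<exists>l::nat.
      fmul sV (binom_pow 1 (int l)) (fsubst sV (binom_pow 1) (Yprod Y u v w))
        = fmul sV (binom_pow 1 (int l)) (Yiter Y Y u v w)"
    and weak_commutativity: "\<And>u v. \<exists>k::nat. \<forall>w.
      fmul sV (binom_pow (-1) (int k)) (Yprod Y u v w)
        = fmul sV (binom_pow (-1) (int k)) (Yprod Y v u w \<circ> prod.swap)"


section \<open>\<open>\<phi>\<^sub>\<epsilon>\<close>-coordinated modules\<close>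

definition xpow_deriv :: "int \<Rightarrow> complex fls \<Rightarrow> complex fls"
  where "xpow_deriv \<epsilon> g = fls_X_intpow \<epsilon> * fls_deriv g"

text \<open>
  \<open>\<phi>\<^sub>\<epsilon>(x, z)\<close> as an element of the field \<open>\<complex>((x))((z))\<close>, so that \<open>\<phi>\<^sub>\<epsilon>(x, z)\<^sup>m\<close> is
  \<^term>\<open>power_int\<close>; these powers lie in \<open>\<complex>((x))[[z]]\<close>.
\<close>

definition phi :: "int \<Rightarrow> complex fls fls"
  where "phi \<epsilon> = fps_to_fls (Abs_fps (\<lambda>n. fls_const (1 / fact n) * (xpow_deriv \<epsilon> ^^ n) fls_X))"

locale phi_coordinated_module = V: vertex_algebra sV Y vac + W: vector_space sW
  for \<epsilon> :: int
    and sV :: "complex \<Rightarrow> 'v \<Rightarrow> 'v::ab_group_add"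
    and Y :: "'v \<Rightarrow> 'v \<Rightarrow> int \<Rightarrow> 'v"
    and vac :: 'v
    and sW :: "complex \<Rightarrow> 'w \<Rightarrow> 'w::ab_group_add" +
  fixes YW :: "'v \<Rightarrow> 'w \<Rightarrow> int \<Rightarrow> 'w"
  assumes YW_linear: "\<And>w n. Vector_Spaces.linear sV sW (\<lambda>v. YW v w n)"
    and YW_Hom: "\<And>v. in_Hom sW laurent1 (YW v)"
    and YW_vacuum: "\<And>w. YW vac w = fmonom 0 w"
    and phi_associativity: "\<And>u v. \<exists>k::nat.
      in_Hom sW laurent2 (\<lambda>w. fmul sW (binom_pow (-1) (int k)) (Yprod YW u v w)) \<and>
      (\<forall>w. fmul sW (ser2 ((phi \<epsilon> - fls_const fls_X) ^ k)) (Yiter Y YW u v w)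
        = fsubst sW (\<lambda>m. ser2 (phi \<epsilon> powi m))
            (fmul sW (binom_pow (-1) (int k)) (Yprod YW u v w)))"


section \<open>Ingredients of the Jacobi-type identity\<close>

text \<open>\<open>f\<^sub>\<epsilon>(x, z)\<close> as an element of the field \<open>\<complex>((x))((z))\<close>; \<^term>\<open>fps_ln 1\<close> is \<open>log(1 + z)\<close>.\<close>

definition f_eps :: "int \<Rightarrow> complex fls fls"
  where "f_eps \<epsilon> =
    (if \<epsilon> = 1 then fps_to_fls (fps_ln 1)
     else fls_const (fls_X_intpow (1 - \<epsilon>)) * (((1 + fls_X) powi (1 - \<epsilon>) - 1) / of_int (1 - \<epsilon>)))"

text \<open>
  Series in three variables have their exponents listed in the order \<open>(x\<^sub>1, x\<^sub>2, z)\<close>. The following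
  regard a series in \<open>(x\<^sub>1, x\<^sub>2)\<close>, respectively in \<open>(z, x\<^sub>2)\<close>, as a series in three variables.
\<close>

definition emb12 :: "(int \<times> int \<Rightarrow> 'a) \<Rightarrow> int \<times> int \<times> int \<Rightarrow> 'a::zero"
  where "emb12 F = (\<lambda>(a, b, c). if c = 0 then F (a, b) else 0)"

definition embz2 :: "(int \<times> int \<Rightarrow> 'a) \<Rightarrow> int \<times> int \<times> int \<Rightarrow> 'a::zero"
  where "embz2 F = (\<lambda>(a, b, c). if a = 0 then F (c, b) else 0)"

text \<open>\<open>(x\<^sub>2 z)\<^sup>-\<^sup>1 \<delta>((x\<^sub>1 - x\<^sub>2) / (x\<^sub>2 z))\<close>\<close>

definition delta_12 :: "int \<times> int \<times> int \<Rightarrow> complex"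
  where "delta_12 = fmul (*) (fmonom (0, -1, -1) 1)
    (fdelta (\<lambda>n. fmul (*) (emb12 (binom_pow (-1) n)) (fmonom (0, -n, -n) 1)))"

text \<open>\<open>(x\<^sub>2 z)\<^sup>-\<^sup>1 \<delta>((x\<^sub>2 - x\<^sub>1) / (- x\<^sub>2 z))\<close>\<close>

definition delta_21 :: "int \<times> int \<times> int \<Rightarrow> complex"
  where "delta_21 = fmul (*) (fmonom (0, -1, -1) 1)
    (fdelta (\<lambda>n. fmul (*) (emb12 (binom_pow (-1) n \<circ> prod.swap)) (fmonom (0, -n, -n) ((-1) powi (-n)))))"

text \<open>\<open>x\<^sub>1\<^sup>-\<^sup>1 \<delta>(x\<^sub>2 (1 + z) / x\<^sub>1)\<close>\<close>

definition delta_iter :: "int \<times> int \<times> int \<Rightarrow> complex"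
  where "delta_iter = fmul (*) (fmonom (-1, 0, 0) 1)
    (fdelta (\<lambda>n. fmul (*) (fmonom (-n, n, 0) 1) (embz2 (ser2 ((1 + fls_X) powi n)))))"

text \<open>\<open>x\<^sub>2\<^sup>\<epsilon> \<partial>/\<partial>x\<^sub>2\<close> on series in \<open>(x\<^sub>1, x\<^sub>2)\<close>, and \<open>x\<^sub>1\<^bsup>\<epsilon>-1\<^esup> \<delta>(x\<^sub>2 / x\<^sub>1)\<close>\<close>

definition x2pow_deriv :: "int \<Rightarrow> (int \<times> int \<Rightarrow> complex) \<Rightarrow> int \<times> int \<Rightarrow> complex"
  where "x2pow_deriv \<epsilon> g = (\<lambda>(a, b). of_int (b - \<epsilon> + 1) * g (a, b - \<epsilon> + 1))"

definition delta_comm :: "int \<Rightarrow> int \<times> int \<Rightarrow> complex"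
  where "delta_comm \<epsilon> = fmul (*) (fmonom (\<epsilon> - 1, 0) 1) (fdelta (\<lambda>n. fmonom (-n, n) 1))"

text \<open>A series in \<open>x\<^sub>2\<close> regarded as a series in \<open>(x\<^sub>1, x\<^sub>2)\<close>.\<close>

definition emb2 :: "(int \<Rightarrow> 'a) \<Rightarrow> int \<times> int \<Rightarrow> 'a::zero"
  where "emb2 F = (\<lambda>(a, b). if a = 0 then F b else 0)"

end

theory Submission
  imports Defs
begin

unbundle fps_syntax

text \<open>
  Write \<open>\<phi>\<^sub>\<epsilon>(x, z) = x \<psi>(x\<^bsup>\<epsilon>-1\<^esup> z)\<close> and \<open>f\<^sub>\<epsilon>(x, z) = x\<^bsup>1-\<epsilon>\<^esup> g(z)\<close>. Then \<open>\<psi>' = \<psi>\<^sup>\<epsilon>\<close>, \<open>g' = (1 + z)\<^bsup>-\<epsilon>\<^esup>\<close> and \<open>\<psi>(g(z)) = 1 + z\<close>.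
  All axioms are homogeneous, so after applying a linear functional and fixing the total degree they
  become identities between Laurent series over \<open>\<complex>\<close> in one variable. On such a line,
  \<open>\<phi>\<^sub>\<epsilon>\<close>-associativity says that the product and the iterate expand one and the same Laurent polynomial
  divided by \<open>(x\<^sub>1 - x\<^sub>2)\<^sup>k\<close>. Skew symmetry of the vertex algebra, transported to the module by
  \<open>Y\<^sub>W(Y(v, x\<^sub>0) \<one>, x\<^sub>2) = Y\<^sub>W(v, \<phi>\<^sub>\<epsilon>(x\<^sub>2, x\<^sub>0))\<close>, shows that the product in the opposite order expands it as
  well; here \<open>\<theta>(z) = -z \<psi>(z)\<^bsup>\<epsilon>-1\<^esup>\<close> plays the role of the inverse flow, \<open>\<psi>(\<theta>(z)) = 1 / \<psi>(z)\<close>. The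
  Jacobi identity is then the delta function identity for the three expansions of \<open>(x\<^sub>1 - x\<^sub>2)\<^sup>n\<close>, and its
  residue in \<open>z\<close> is the commutator formula.
\<close>

text \<open>A coordinated module carries no commutativity axiom, and the two orders of the product
  are expansions in different domains, so they can be compared only through the iterate, that is, as
  series in \<open>psi\<close>. The comparison returns to a free variable because a Laurent
  polynomial with complex coefficients is determined by its value at one transcendental series, and
  \<open>psi\<close> is one. Linear functionals enter because vectors cannot be divided: a scalar
  line lies in a field of Laurent series, where powers of \<open>x\<^sub>1 - x\<^sub>2\<close>
  cancel. The formula for \<theta> comes from flowing by z and then by -z: at the base point x
  \<psi> the time -z is rescaled by \<psi>^(\<epsilon>-1).\<close>

section \<open>Sums with finite support\<close>

lemma Sum_any_reindex:
  assumes "inj h" and "\<And>x. x \<notin> range h \<Longrightarrow> f x = 0"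
  shows "Sum_any f = Sum_any (\<lambda>j. f (h j))"
proof -
  have eq: "{x. f x \<noteq> 0} = h ` {j. f (h j) \<noteq> 0}" using assms(2) by (auto simp: image_iff) (metis rangeE)
  have "sum f (h ` {j. f (h j) \<noteq> 0}) = sum (f \<circ> h) {j. f (h j) \<noteq> 0}"
    using assms(1) by (intro sum.reindex) (auto simp: inj_on_def)
  thus ?thesis by (simp add: Sum_any.expand_set eq o_def)
qed

lemma Sum_any_single:
  assumes "\<And>x. x \<noteq> a \<Longrightarrow> f x = 0"
  shows "Sum_any f = f a"
proof -
  have "f = (\<lambda>x. if x = a then f x else 0)" using assms by auto
  thus ?thesis by (metis Sum_any.delta)
qed

lemma finite_support_int:
  fixes N M :: int
  assumes "\<And>i. i < N \<Longrightarrow> f i = 0" "\<And>i. i > M \<Longrightarrow> f i = 0"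
  shows "finite {i. f i \<noteq> 0}"
proof (rule finite_subset)
  show "{i. f i \<noteq> 0} \<subseteq> {N..M}"
  proof
    fix i assume "i \<in> {i. f i \<noteq> 0}"
    hence "\<not> i < N" "\<not> i > M" using assms by auto
    thus "i \<in> {N..M}" by simp
  qed
qed simp

section \<open>Linear functionals\<close>

definition functional :: "(complex \<Rightarrow> 'w \<Rightarrow> 'w::ab_group_add) \<Rightarrow> ('w \<Rightarrow> complex) \<Rightarrow> bool"
  where "functional s \<mu> \<longleftrightarrow> (\<forall>x y. \<mu> (x + y) = \<mu> x + \<mu> y) \<and> (\<forall>c x. \<mu> (s c x) = c * \<mu> x)"

lemma functional_add: "functional s \<mu> \<Longrightarrow> \<mu> (x + y) = \<mu> x + \<mu> y"
  and functional_scale: "functional s \<mu> \<Longrightarrow> \<mu> (s c x) = c * \<mu> x"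
  by (auto simp: functional_def)

lemma functional_0: "functional s \<mu> \<Longrightarrow> \<mu> 0 = 0"
  using functional_add[of s \<mu> 0 0] by simp

lemma functional_diff: "functional s \<mu> \<Longrightarrow> \<mu> (x - y) = \<mu> x - \<mu> y"
  using functional_add[of s \<mu> "x - y" y] by simp

lemma functional_sum: "functional s \<mu> \<Longrightarrow> \<mu> (sum f A) = (\<Sum>x\<in>A. \<mu> (f x))"
  by (induction A rule: infinite_finite_induct) (auto simp: functional_0 functional_add)

lemma functional_Sum_any:
  assumes "functional s \<mu>" "finite {x. f x \<noteq> 0}"
  shows "\<mu> (Sum_any f) = Sum_any (\<lambda>x. \<mu> (f x))"
proof -
  have "Sum_any (\<lambda>x. \<mu> (f x)) = (\<Sum>x\<in>{x. f x \<noteq> 0}. \<mu> (f x))"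
    using assms by (intro Sum_any.expand_superset) (auto simp: functional_0)
  thus ?thesis using functional_sum[OF assms(1)] by (simp add: Sum_any.expand_set)
qed

text \<open>The coordinate functionals of a Hamel basis separate vectors, in any dimension.\<close>

lemma eq_if_functionals_eq:
  fixes s :: "complex \<Rightarrow> 'w \<Rightarrow> 'w::ab_group_add"
  assumes "vector_space s" "\<And>\<mu>. functional s \<mu> \<Longrightarrow> \<mu> x = \<mu> y"
  shows "x = y"
proof -
  interpret vector_space s by fact
  define B where "B = extend_basis {}"
  have B: "independent B" "span B = UNIV"
    unfolding B_def by (simp_all add: independent_extend_basis independent_empty)
  have "functional s (\<lambda>v. representation B v b)" for b
    using B by (simp add: functional_def representation_add representation_scale)
  hence "representation B x = representation B y" using assms(2) by blast
  thus ?thesis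
    using B by (metis UNIV_I sum_nonzero_representation_eq)
qed

section \<open>Products, substitutions and powers of Laurent series\<close>

lemma laurent1_nth:
  "laurent1 f \<Longrightarrow> Abs_fls f $$ n = f n"
  unfolding laurent1_def by (rule nth_Abs_fls_ex_lower_bound) blast

lemma fls_times_Sum_any:
  fixes f g :: "'a::semiring_0 fls"
  shows "(f * g) $$ c = Sum_any (\<lambda>i. f $$ i * g $$ (c - i))"
proof -
  let ?S = "{fls_subdegree f..c - fls_subdegree g}"
  have "(f * g) $$ c = (\<Sum>i = fls_subdegree f + fls_subdegree g..c. f $$ (i - fls_subdegree g) * g $$ (fls_subdegree g + c - i))"
    by (rule fls_times_nth)
  also have "\<dots> = (\<Sum>i\<in>?S. f $$ i * g $$ (c - i))"
    by (rule sum.reindex_bij_witness[of _ "\<lambda>i. i + fls_subdegree g" "\<lambda>i. i - fls_subdegree g"])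
       (auto simp: algebra_simps)
  also have "\<dots> = Sum_any (\<lambda>i. f $$ i * g $$ (c - i))"
  proof (rule Sum_any.expand_superset[symmetric])
    show "{a. f $$ a * g $$ (c - a) \<noteq> 0} \<subseteq> ?S"
    proof
      fix a assume "a \<in> {a. f $$ a * g $$ (c - a) \<noteq> 0}"
      hence "f $$ a \<noteq> 0" "g $$ (c - a) \<noteq> 0" by auto
      thus "a \<in> ?S" using fls_subdegree_leI[of f a] fls_subdegree_leI[of g "c-a"] by auto
    qed
  qed auto
  finally show ?thesis .
qed

lemma fls_times_nth_sum:
  fixes f g :: "'a::semiring_0 fls"
  assumes "\<And>i. i < M \<Longrightarrow> f $$ i = 0" "\<And>i. i < N \<Longrightarrow> g $$ i = 0"
  shows "(f * g) $$ c = (\<Sum>i\<in>{M..c-N}. f $$ i * g $$ (c - i))"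
  unfolding fls_times_Sum_any
proof (rule Sum_any.expand_superset)
  show "{i. f $$ i * g $$ (c - i) \<noteq> 0} \<subseteq> {M..c-N}"
  proof
    fix i assume "i \<in> {i. f $$ i * g $$ (c - i) \<noteq> 0}"
    hence "\<not> i < M" "\<not> c - i < N" using assms by auto
    thus "i \<in> {M..c-N}" by auto
  qed
qed auto

lemma fls_compose_fps_sum:
  assumes "h $ 0 = 0" "h \<noteq> 0"
  shows "fls_compose_fps (\<Sum>n\<in>A. F n :: complex fls) h = (\<Sum>n\<in>A. fls_compose_fps (F n) h)"
  using assms by (induction A rule: infinite_finite_induct) (simp_all add: fls_compose_fps_add)

text \<open>Since \<open>h\<close> has positive order, \<open>q * h^m\<close> starts above degree
  \<open>c\<close> for large \<open>m\<close>, so only finitely many terms matter. The factor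
  \<open>q\<close> is carried along because the applications multiply the substituted series by a
  power of \<open>1 + z\<close> or of \<open>psi\<close>.\<close>

lemma fls_compose_fps_nth:
  fixes p q :: "complex fls"
  assumes h: "fps_nth h 0 = 0" "h \<noteq> 0"
  shows "(q * fls_compose_fps p h) $$ c = Sum_any (\<lambda>m. p $$ m * (q * fps_to_fls h powi m) $$ c)"
proof -
  let ?H = "fps_to_fls h"
  have H0: "?H \<noteq> 0" using h by simp
  have sd: "subdegree h \<ge> 1" using h by (simp add: Suc_leI subdegree_eq_0_iff flip: neq0_conv)
  have van: "(q * ?H powi m * fps_to_fls r) $$ c = 0" if m: "m > max 0 (c - fls_subdegree q)" for m r
  proof (cases "q = 0 \<or> r = 0")
    case False
    have "fls_subdegree (q * ?H powi m * fps_to_fls r)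
        = fls_subdegree q + m * int (subdegree h) + int (subdegree r)"
      using False H0 by (simp add: fls_subdegree_fls_to_fps)
    moreover have "m * int (subdegree h) \<ge> m * 1" using sd m by (intro mult_left_mono) auto
    ultimately have "c < fls_subdegree (q * ?H powi m * fps_to_fls r)" using m by linarith
    thus ?thesis by (rule fls_eq0_below_subdegree)
  qed auto
  have v1: "(q * ?H powi m) $$ c = 0" if "m > max 0 (c - fls_subdegree q)" for m
    using van[OF that, of 1] by simp
  \<comment> \<open>From degree \<open>N\<close> on no power of \<open>h\<close> reaches down to the
    coefficient \<open>c\<close>; \<open>p1\<close> is the part of \<open>p\<close> below
    \<open>N\<close>, a Laurent polynomial to which additivity applies.\<close>
  define N where "N = max 0 (c - fls_subdegree q) + 1"
  define M where "M = min N (fls_subdegree p)"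
  define p1 where "p1 = (\<Sum>m = M..<N. fls_const (p $$ m) * fls_X_intpow m)"
  define r where "r = fls_regpart (fls_shift N (p - p1))"
  have p1n: "p1 $$ i = (if M \<le> i \<and> i < N then p $$ i else 0)" for i
  proof -
    have "p1 $$ i = (\<Sum>m = M..<N. if i = m then p $$ m else 0)"
      unfolding p1_def fls_nth_sum by (intro sum.cong) auto
    thus ?thesis by simp
  qed
  have low: "(p - p1) $$ i = 0" if "i < N" for i
    using that by (auto simp: p1n M_def)
  have "fls_shift N (p - p1) = fps_to_fls r"
    unfolding r_def by (rule fls_regpart_to_fls_trivial[symmetric], rule fls_subdegree_ge0I)
      (use low in auto)
  hence "p - p1 = fls_X_intpow N * fps_to_fls r"
    by (metis add.right_inverse fls_X_intpow_times_conv_shift(1) fls_shift_0 fls_shift_fls_shift)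
  hence p: "p = p1 + fls_X powi N * fps_to_fls r" by (simp add: algebra_simps)
  have cp1: "fls_compose_fps p1 h = (\<Sum>m = M..<N. fls_const (p $$ m) * ?H powi m)"
    unfolding p1_def fls_compose_fps_sum[OF h]
    by (intro sum.cong refl) (simp add: fls_compose_fps_mult h fls_compose_fps_powi flip: fls_X_power_int)
  have "fls_compose_fps p h = fls_compose_fps p1 h + ?H powi N * fps_to_fls (r oo h)"
    using h by (subst p) (simp add: fls_compose_fps_add fls_compose_fps_mult fls_compose_fps_powi del: fls_X_power_int)
  hence "(q * fls_compose_fps p h) $$ c = (q * fls_compose_fps p1 h) $$ c + (q * ?H powi N * fps_to_fls (r oo h)) $$ c"
    by (simp add: algebra_simps)
  also have "(q * ?H powi N * fps_to_fls (r oo h)) $$ c = 0" by (rule van) (simp add: N_def)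
  also have "(q * fls_compose_fps p1 h) $$ c = (\<Sum>m = M..<N. p $$ m * (q * ?H powi m) $$ c)"
    unfolding cp1 sum_distrib_left fls_nth_sum
    by (intro sum.cong refl) (metis (no_types, lifting) fls_mult_const_nth(1) mult.left_commute)
  also have "\<dots> = Sum_any (\<lambda>m. p $$ m * (q * ?H powi m) $$ c)"
  proof (rule Sum_any.expand_superset[symmetric])
    show "{m. p $$ m * (q * ?H powi m) $$ c \<noteq> 0} \<subseteq> {M..<N}"
    proof
      fix m assume "m \<in> {m. p $$ m * (q * ?H powi m) $$ c \<noteq> 0}"
      hence "p $$ m \<noteq> 0" "(q * ?H powi m) $$ c \<noteq> 0" by auto
      thus "m \<in> {M..<N}" using v1[of m] fls_subdegree_leI[of p m] by (force simp: N_def M_def)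
    qed
  qed auto
  finally show "(q * fls_compose_fps p h) $$ c = Sum_any (\<lambda>m. p $$ m * (q * ?H powi m) $$ c)" by simp
qed

lemma one_plus_cX_powi_nth:
  assumes "c \<noteq> 0"
  shows "((1 + fls_const c * fls_X) powi n) $$ j
    = (if j \<ge> 0 then (of_int n gchoose nat j) * c ^ nat j else (0::complex))"
proof -
  have "fls_compose_fps ((1 + fls_X) powi n) (fps_const c * fps_X) = (1 + fls_const c * fls_X) powi n"
    using assms by (simp add: fls_compose_fps_powi fls_compose_fps_add fls_times_fps_to_fls)
  hence "((1 + fls_const c * fls_X) powi n) $$ j = ((1 + fls_X) powi n) $$ j * c powi j"
    using fls_nth_fls_compose_fps_linear[OF assms, of "(1 + fls_X) powi n" j] by simp
  moreover have "c powi j = c ^ nat j" if "j \<ge> 0" using that by (simp add: power_int_def)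
  ultimately show ?thesis by (simp only: one_plus_fls_X_powi_eq) simp
qed

lemma fls_deriv_powi:
  fixes f :: "complex fls"
  assumes "f \<noteq> 0"
  shows "fls_deriv (f powi n) = of_int n * f powi (n - 1) * fls_deriv f"
proof -
  have pos: "fls_deriv (f powi int n) = of_int (int n) * f powi (int n - 1) * fls_deriv f"
    if "f \<noteq> 0" for f :: "complex fls" and n
  proof (induction n)
    case (Suc n)
    have "fls_deriv (f powi int (Suc n)) = fls_deriv f * f powi int n + f * fls_deriv (f powi int n)"
      by (simp add: power_int_def nat_add_distrib)
    also have "f * fls_deriv (f powi int n) = of_nat n * (f * f powi (int n - 1)) * fls_deriv f"
      by (simp add: Suc.IH del: power_int_of_nat)
    also have "f * f powi (int n - 1) = f powi int n"
      using that power_int_add[of f 1 "int n - 1"] by (simp del: power_int_of_nat)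
    finally show ?case by (simp add: algebra_simps del: power_int_of_nat)
  qed simp
  show ?thesis
  proof (cases "n \<ge> 0")
    case True
    thus ?thesis using pos[OF assms, of "nat n"] by simp
  next
    case False
    define m where "m = nat (- n)"
    have n: "n = - int m" using False by (simp add: m_def)
    have "f * fls_deriv (inverse f) + fls_deriv f * inverse f = fls_deriv (f * inverse f)" by simp
    also have "\<dots> = 0" using assms by simp
    finally have "f * fls_deriv (inverse f) = - (fls_deriv f * inverse f)"
      by (simp only: add_eq_0_iff2)
    hence "inverse f * (f * fls_deriv (inverse f)) = inverse f * (- (fls_deriv f * inverse f))"
      by simp
    moreover have "inverse f * (f * fls_deriv (inverse f)) = fls_deriv (inverse f)"
      using assms by (simp flip: mult.assoc)
    ultimately have d: "fls_deriv (inverse f) = - (f powi (- 1) * f powi (- 1)) * fls_deriv f"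
      by (simp add: power_int_minus mult_ac)
    have i: "f powi n = inverse f powi int m" by (simp add: n power_int_minus power_inverse)
    have "fls_deriv (f powi n) = of_int (int m) * f powi (- (int m - 1)) * fls_deriv (inverse f)"
      unfolding i power_int_minus[of f] power_int_inverse[symmetric]
      using assms by (subst pos) simp_all
    also have "\<dots> = - of_int (int m) * (f powi (- (int m - 1)) * f powi (- 1) * f powi (- 1)) * fls_deriv f"
      unfolding d by (simp add: mult_ac del: power_int_of_nat)
    also have "f powi (- (int m - 1)) * f powi (- 1) * f powi (- 1) = f powi (n - 1)"
      using assms by (simp add: n del: power_int_minus1_right flip: power_int_add)
    finally show ?thesis by (simp add: n)
  qed
qed

text \<open>A series with constant term 1 is a unit, so its negative powers are power series too.
  This allows constant terms and regular parts of powers of \<open>Psi\<close> to be taken.\<close>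

lemma fps_powi:
  fixes f :: "complex fps"
  assumes "f $ 0 = 1"
  obtains h where "h $ 0 = 1" "fps_to_fls f powi n = fps_to_fls h"
proof (cases "n \<ge> 0")
  case True
  show ?thesis
    by (rule that[of "f ^ nat n"]) (use assms True in \<open>simp_all add: power_int_def fps_to_fls_power fps_nth_power_0\<close>)
next
  case False
  show ?thesis
    by (rule that[of "inverse f ^ nat (- n)"])
      (use assms False in \<open>simp_all add: fps_nth_power_0 power_int_def fps_to_fls_power fls_inverse_fps_to_fls\<close>)
qed

section \<open>The series \<open>\<psi>\<close> and \<open>g\<close>\<close>

text \<open>This is (1 - (\<epsilon>-1) z)^(-1/(\<epsilon>-1)), and e^z for \<epsilon> = 1; giving
  the coefficients covers both cases at once. The product arises from iterating
  \<open>x^\<epsilon> d/dx\<close> on x.\<close>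

definition psi :: "int \<Rightarrow> complex fps"
  where "psi \<epsilon> = Abs_fps (\<lambda>c. (\<Prod>i<c. 1 + of_int (\<epsilon> - 1) * of_nat i) / fact c)"

text \<open>As an antiderivative it covers the power and the logarithm branch of
  \<open>f_eps\<close> uniformly.\<close>

definition g_eps :: "int \<Rightarrow> complex fps"
  where "g_eps \<epsilon> = fps_integral0 (fps_binomial (of_int (- \<epsilon>)))"

abbreviation Psi :: "int \<Rightarrow> complex fls"
  where "Psi \<epsilon> \<equiv> fps_to_fls (psi \<epsilon>)"

lemma psi_nth_0 [simp]: "psi \<epsilon> $ 0 = 1" and psi_nth_1 [simp]: "psi \<epsilon> $ Suc 0 = 1"
  by (simp_all add: psi_def)

lemma psi_nonzero [simp]: "psi \<epsilon> \<noteq> 0"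
  by (metis psi_nth_0 fps_zero_nth zero_neq_one)

text \<open>A linear equation is a recursion between neighbouring coefficients and can be read off
  the definition; the nonlinear equation \<open>Psi_deriv\<close> is derived from it.\<close>

lemma psi_linear_ode:
  "(1 - fps_const (of_int (\<epsilon> - 1)) * fps_X) * fps_deriv (psi \<epsilon>) = psi \<epsilon>"
proof (rule fps_ext)
  fix c
  let ?r = "of_int (\<epsilon> - 1) :: complex"
  have rec: "of_nat (Suc c) * psi \<epsilon> $ Suc c = (1 + ?r * of_nat c) * psi \<epsilon> $ c" for c
    by (simp add: psi_def field_simps del: of_nat_Suc)
  have "(fps_X * fps_deriv (psi \<epsilon>)) $ c = of_nat c * psi \<epsilon> $ c" by (cases c) auto
  hence "(fps_const ?r * fps_X * fps_deriv (psi \<epsilon>)) $ c = ?r * (of_nat c * psi \<epsilon> $ c)"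
    by (simp add: mult.assoc)
  thus "((1 - fps_const ?r * fps_X) * fps_deriv (psi \<epsilon>)) $ c = psi \<epsilon> $ c"
    using rec[of c] by (simp add: left_diff_distrib distrib_right mult.assoc del: of_int_diff)
qed

lemma Psi_linear_ode: "(1 - of_int (\<epsilon> - 1) * fls_X) * fls_deriv (Psi \<epsilon>) = Psi \<epsilon>"
proof -
  have "fps_to_fls ((1 - fps_const (of_int (\<epsilon> - 1)) * fps_X) * fps_deriv (psi \<epsilon>)) = Psi \<epsilon>"
    by (simp only: psi_linear_ode)
  thus ?thesis
    by (simp add: fls_times_fps_to_fls fls_deriv_fps_to_fls fls_of_int del: of_int_diff)
qed

text \<open>By the linear equation the derivative of the left side vanishes, and its constant term
  is 1.\<close>

lemma Psi_powi_r:
  "Psi \<epsilon> powi (\<epsilon> - 1) * (1 - of_int (\<epsilon> - 1) * fls_X) = 1"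
proof -
  let ?r = "\<epsilon> - 1" and ?L = "1 - of_int (\<epsilon> - 1) * fls_X :: complex fls"
  define y where "y = Psi \<epsilon> powi ?r * ?L"
  note ode = Psi_linear_ode[of \<epsilon>]
  have "fls_deriv y = of_int ?r * Psi \<epsilon> powi (?r - 1) * (?L * fls_deriv (Psi \<epsilon>)) - of_int ?r * Psi \<epsilon> powi ?r"
    unfolding y_def by (simp add: fls_deriv_powi algebra_simps del: of_int_diff)
  also have "\<dots> = of_int ?r * (Psi \<epsilon> powi (?r - 1) * Psi \<epsilon>) - of_int ?r * Psi \<epsilon> powi ?r"
    unfolding ode by (simp add: algebra_simps)
  also have "Psi \<epsilon> powi (?r - 1) * Psi \<epsilon> = Psi \<epsilon> powi ?r"
    using power_int_add[of "Psi \<epsilon>" "?r - 1" 1] by simp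
  finally have "fls_deriv y = 0" by simp
  hence y: "y = fls_const (y $$ 0)" by (simp only: fls_deriv_eq_0_iff)
  obtain h where h: "h $ 0 = 1" "Psi \<epsilon> powi ?r = fps_to_fls h"
    using fps_powi[OF psi_nth_0] by blast
  have "y = fps_to_fls (h * (1 - of_int ?r * fps_X))"
    by (simp add: y_def h fls_times_fps_to_fls fps_to_fls_of_int del: of_int_diff)
  hence "y $$ 0 = 1" using h by simp
  with y show ?thesis by (simp add: y_def)
qed

lemma Psi_deriv: "fls_deriv (Psi \<epsilon>) = Psi \<epsilon> powi \<epsilon>"
proof -
  let ?r = "\<epsilon> - 1" and ?L = "1 - of_int (\<epsilon> - 1) * fls_X :: complex fls"
  note ode = Psi_linear_ode[of \<epsilon>]
  have "fls_deriv (Psi \<epsilon>) = Psi \<epsilon> powi ?r * (?L * fls_deriv (Psi \<epsilon>))"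
    using Psi_powi_r[of \<epsilon>] by (simp flip: mult.assoc)
  also have "\<dots> = Psi \<epsilon> powi \<epsilon>"
    using power_int_add[of "Psi \<epsilon>" "?r" 1] by (simp only: ode) simp
  finally show ?thesis .
qed

lemma g_eps_nth_0 [simp]: "g_eps \<epsilon> $ 0 = 0"
  and g_eps_nth_1 [simp]: "g_eps \<epsilon> $ Suc 0 = 1"
  by (simp_all add: g_eps_def fps_integral_def)

lemma g_eps_nonzero [simp]: "g_eps \<epsilon> \<noteq> 0"
  by (metis g_eps_nth_1 fps_zero_nth zero_neq_one)

lemma g_eps_deriv: "fps_to_fls (fps_deriv (g_eps \<epsilon>)) = (1 + fls_X) powi (- \<epsilon>)"
  by (simp add: g_eps_def one_plus_fls_X_powi_eq fps_deriv_fps_integral)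

lemma g_eps_compose_deriv:
  assumes h: "h $ 0 = 0" "h \<noteq> 0"
  shows "fls_deriv (fps_to_fls (g_eps \<epsilon> oo h)) = (1 + fps_to_fls h) powi (- \<epsilon>) * fls_deriv (fps_to_fls h)"
proof -
  have "fls_deriv (fps_to_fls (g_eps \<epsilon> oo h)) = fps_to_fls (fps_deriv (g_eps \<epsilon>) oo h) * fls_deriv (fps_to_fls h)"
    by (simp add: fls_deriv_fps_to_fls fps_compose_deriv[OF h(1)] fls_times_fps_to_fls)
  also have "fps_to_fls (fps_deriv (g_eps \<epsilon>) oo h) = fls_compose_fps ((1 + fls_X) powi (- \<epsilon>)) h"
    using h by (simp flip: g_eps_deriv)
  also have "\<dots> = (1 + fps_to_fls h) powi (- \<epsilon>)"
    using h by (simp add: fls_compose_fps_powi fls_compose_fps_add)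
  finally show ?thesis .
qed

lemma fps_eq_if_fls_deriv_eq:
  fixes f g :: "complex fps"
  assumes "fls_deriv (fps_to_fls f) = fls_deriv (fps_to_fls g)" "f $ 0 = g $ 0"
  shows "f = g"
  using assms by (simp add: fls_deriv_fps_to_fls fps_deriv_eq_iff)

lemma psi_minus_1 [simp]: "(psi \<epsilon> - 1) $ 0 = 0" "psi \<epsilon> - 1 \<noteq> 0"
proof -
  have "(psi \<epsilon> - 1) $ 1 = 1" by simp
  thus "psi \<epsilon> - 1 \<noteq> 0" by (metis fps_zero_nth zero_neq_one)
qed simp

lemma psi_neq_1 [simp]: "psi \<epsilon> \<noteq> 1"
  using psi_minus_1(2)[of \<epsilon>] by simp

text \<open>By the chain rule the derivative is \<psi>^(-\<epsilon>) \<psi>' = 1.\<close>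

lemma g_eps_psi: "g_eps \<epsilon> oo (psi \<epsilon> - 1) = fps_X"
proof (rule fps_eq_if_fls_deriv_eq)
  have "fls_deriv (fps_to_fls (g_eps \<epsilon> oo (psi \<epsilon> - 1))) = Psi \<epsilon> powi (- \<epsilon>) * Psi \<epsilon> powi \<epsilon>"
    by (subst g_eps_compose_deriv) (simp_all add: Psi_deriv)
  also have "\<dots> = 1" by (simp add: power_int_minus)
  finally show "fls_deriv (fps_to_fls (g_eps \<epsilon> oo (psi \<epsilon> - 1))) = fls_deriv (fps_to_fls fps_X)" by simp
qed simp

text \<open>\<open>psi - 1\<close> has a nonzero linear term and hence a compositional inverse;
  \<open>g_eps\<close>, being inverse on one side, must coincide with it.\<close>

lemma psi_g_eps: "(psi \<epsilon> - 1) oo g_eps \<epsilon> = fps_X"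
proof -
  let ?a = "psi \<epsilon> - 1"
  have a: "?a $ 0 = 0" "?a $ 1 \<noteq> 0" by simp_all
  have i0: "fps_inv ?a $ 0 = 0" by (simp add: fps_inv_def)
  have "g_eps \<epsilon> = g_eps \<epsilon> oo (?a oo fps_inv ?a)" by (simp add: fps_inv_right[OF a])
  also have "\<dots> = g_eps \<epsilon> oo ?a oo fps_inv ?a" by (rule fps_compose_assoc[OF i0 a(1)])
  also have "\<dots> = fps_inv ?a" unfolding g_eps_psi by (simp add: i0)
  finally show ?thesis using fps_inv_right[OF a] by simp
qed

lemma Psi_compose_g_eps: "fls_compose_fps (Psi \<epsilon>) (g_eps \<epsilon>) = 1 + fls_X"
proof -
  have "psi \<epsilon> oo g_eps \<epsilon> = 1 + fps_X"
    using psi_g_eps[of \<epsilon>] by (simp add: fps_compose_sub_distrib algebra_simps)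
  thus ?thesis by simp
qed

text \<open>The regular part only turns a power of \<open>Psi\<close>, which has order 0, back into
  a power series. By \<open>Psi_powi_r\<close> the result is -z / (1 - (\<epsilon>-1) z).\<close>

definition theta :: "int \<Rightarrow> complex fps"
  where "theta \<epsilon> = - fps_X * fls_regpart (Psi \<epsilon> powi (\<epsilon> - 1))"

lemma fls_theta: "fps_to_fls (theta \<epsilon>) = - fls_X * Psi \<epsilon> powi (\<epsilon> - 1)"
proof -
  obtain h where "h $ 0 = 1" "Psi \<epsilon> powi (\<epsilon> - 1) = fps_to_fls h"
    using fps_powi[OF psi_nth_0] by blast
  thus ?thesis by (simp add: theta_def fls_times_fps_to_fls)
qed

lemma theta_nth_0 [simp]: "theta \<epsilon> $ 0 = 0"
  by (simp add: theta_def)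

lemma theta_nonzero [simp]: "theta \<epsilon> \<noteq> 0"
proof -
  have "fps_to_fls (theta \<epsilon>) \<noteq> 0" unfolding fls_theta by simp
  thus ?thesis by auto
qed

text \<open>Both sides have constant term 0 and derivative -\<psi>^(2(\<epsilon>-1)); on the right,
  \<open>Psi_powi_r\<close> absorbs the term that contains z explicitly.\<close>

lemma g_eps_inverse_psi: "g_eps \<epsilon> oo (inverse (psi \<epsilon>) - 1) = theta \<epsilon>"
proof (rule fps_eq_if_fls_deriv_eq)
  let ?P = "Psi \<epsilon>" and ?r = "\<epsilon> - 1"
  let ?L = "1 - of_int ?r * fls_X :: complex fls"
  have nz: "inverse (psi \<epsilon>) - 1 \<noteq> 0"
    by (metis eq_iff_diff_eq_0 fps_inverse_idempotent fps_inverse_one psi_minus_1(2) psi_nth_0 zero_neq_one)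
  have inv: "fps_to_fls (inverse (psi \<epsilon>)) = ?P powi (-1)"
    by (simp add: power_int_minus fls_inverse_fps_to_fls)
  have dinv: "fls_deriv (fps_to_fls (inverse (psi \<epsilon>))) = - (?P powi (-1 - 1) * ?P powi \<epsilon>)"
    unfolding inv by (subst fls_deriv_powi) (simp_all add: Psi_deriv)
  have "fls_deriv (fps_to_fls (g_eps \<epsilon> oo (inverse (psi \<epsilon>) - 1)))
      = (?P powi (-1)) powi (- \<epsilon>) * - (?P powi (-1 - 1) * ?P powi \<epsilon>)"
    using nz by (subst g_eps_compose_deriv)
      (simp_all only: fps_to_fls_minus fls_deriv_sub dinv, simp_all add: inv del: power_int_minus1_right)
  also have "\<dots> = - (?P powi \<epsilon> * ?P powi (-1 - 1) * ?P powi \<epsilon>)"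
    by (simp only: power_int_mult[symmetric]) simp
  also have "?P powi \<epsilon> * ?P powi (-1 - 1) * ?P powi \<epsilon> = ?P powi (2 * ?r)"
    by (simp flip: power_int_add)
  finally have lhs: "fls_deriv (fps_to_fls (g_eps \<epsilon> oo (inverse (psi \<epsilon>) - 1))) = - (?P powi (2 * ?r))" .
  have "fls_deriv (fps_to_fls (theta \<epsilon>)) = - (?P powi ?r) - fls_X * (of_int ?r * (?P powi (?r - 1) * ?P powi \<epsilon>))"
    unfolding fls_theta by (simp add: fls_deriv_powi Psi_deriv algebra_simps)
  also have "?P powi (?r - 1) * ?P powi \<epsilon> = ?P powi (2 * ?r)"
    by (simp flip: power_int_add)
  also have "?P powi (2 * ?r) = ?P powi ?r * ?P powi ?r"
    by (simp flip: power_int_add)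
  also have "- (?P powi ?r) - fls_X * (of_int ?r * (?P powi ?r * ?P powi ?r)) = - (?P powi ?r * ?P powi ?r)"
  proof -
    have "?P powi ?r = ?P powi ?r * (?P powi ?r * ?L)" by (simp only: Psi_powi_r) simp
    hence "?P powi ?r = ?P powi ?r * ?P powi ?r - fls_X * (of_int ?r * (?P powi ?r * ?P powi ?r))"
      by (simp only: right_diff_distrib mult_1_right mult_1_left mult_ac)
    moreover have "- x - z = - y" if "x = y - z" for x y z :: "complex fls" using that by simp
    ultimately show ?thesis by blast
  qed
  also have "\<dots> = - (?P powi (2 * ?r))"
    by (simp flip: power_int_add)
  finally show "fls_deriv (fps_to_fls (g_eps \<epsilon> oo (inverse (psi \<epsilon>) - 1))) = fls_deriv (fps_to_fls (theta \<epsilon>))"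
    using lhs by simp
qed simp

lemma Psi_compose_theta: "fls_compose_fps (Psi \<epsilon>) (theta \<epsilon>) = inverse (Psi \<epsilon>)"
proof -
  let ?i = "inverse (psi \<epsilon>) - 1"
  have "(psi \<epsilon> - 1) oo theta \<epsilon> = (psi \<epsilon> - 1) oo (g_eps \<epsilon> oo ?i)"
    by (simp add: g_eps_inverse_psi)
  also have "\<dots> = (psi \<epsilon> - 1) oo g_eps \<epsilon> oo ?i" by (rule fps_compose_assoc) simp_all
  also have "\<dots> = ?i" unfolding psi_g_eps by simp
  finally have "psi \<epsilon> oo theta \<epsilon> = inverse (psi \<epsilon>)"
    by (simp add: fps_compose_sub_distrib)
  thus ?thesis by (simp add: fls_inverse_fps_to_fls)
qed

section \<open>Laurent polynomial identities\<close>

definition ev :: "complex fls \<Rightarrow> complex poly \<Rightarrow> complex fls"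
  where "ev \<xi> q = poly (map_poly fls_const q) \<xi>"

lemma ev_1 [simp]: "ev \<xi> 1 = 1"
  by (simp add: ev_def)

lemma ev_pCons [simp]: "ev \<xi> (pCons a q) = fls_const a + \<xi> * ev \<xi> q" and ev_0 [simp]: "ev \<xi> 0 = 0"
  by (auto simp: ev_def map_poly_pCons)

lemma ev_add [simp]: "ev \<xi> (p + q) = ev \<xi> p + ev \<xi> q"
proof -
  have "map_poly fls_const (p + q) = map_poly fls_const p + map_poly fls_const q"
    by (rule poly_eqI) (simp add: coeff_map_poly fls_plus_const)
  thus ?thesis by (simp add: ev_def)
qed

lemma ev_smult [simp]: "ev \<xi> (smult a q) = fls_const a * ev \<xi> q"
  by (induction q) (auto simp: algebra_simps simp flip: fls_const_mult_const)

lemma ev_mult [simp]: "ev \<xi> (p * q) = ev \<xi> p * ev \<xi> q"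
  by (induction p) (auto simp: algebra_simps)

lemma ev_pcompose: "ev \<xi> (pcompose q p) = ev (ev \<xi> p) q"
  by (induction q) (auto simp: pcompose_pCons)

lemma ev_X_eq_0_iff: "ev fls_X q = 0 \<longleftrightarrow> q = 0"
proof -
  have "ev fls_X q = fps_to_fls (fps_of_poly q)"
    by (induction q) (auto simp: fps_of_poly_pCons fls_times_fps_to_fls)
  thus ?thesis by simp
qed

lemma ev_compose:
  assumes "h $ 0 = 0" "h \<noteq> 0"
  shows "fls_compose_fps (ev \<xi> q) h = ev (fls_compose_fps \<xi> h) q"
  using assms by (induction q) (auto simp: fls_compose_fps_add fls_compose_fps_mult)

text \<open>Transcendence of \<psi>: substituting \<open>g_eps\<close> is injective and turns \<psi>
  into 1 + z, where a polynomial vanishes only if it is zero.\<close>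

lemma ev_Psi_eq_0_iff: "ev (Psi \<epsilon>) q = 0 \<longleftrightarrow> q = 0"
proof -
  have "ev (Psi \<epsilon>) q = 0 \<longleftrightarrow> fls_compose_fps (ev (Psi \<epsilon>) q) (g_eps \<epsilon>) = 0"
    by (simp add: fls_compose_fps_eq_0_iff)
  also have "fls_compose_fps (ev (Psi \<epsilon>) q) (g_eps \<epsilon>) = ev fls_X (pcompose q [:1, 1:])"
    by (simp add: ev_compose Psi_compose_g_eps ev_pcompose del: fls_compose_fps_to_fls)
  also have "\<dots> = 0 \<longleftrightarrow> q = 0"
    by (simp add: ev_X_eq_0_iff pcompose_eq_0_iff)
  finally show ?thesis .
qed

text \<open>The exponent \<open>M\<close> and the polynomial \<open>q\<close> are chosen before
  \<xi>; this uniformity lets a single evaluation decide all the others.\<close>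

definition laurent_poly :: "(complex fls \<Rightarrow> complex fls) \<Rightarrow> bool"
  where "laurent_poly F \<longleftrightarrow> (\<exists>M q. \<forall>\<xi>. \<xi> \<noteq> 0 \<longrightarrow> \<xi> ^ M * F \<xi> = ev \<xi> q)"

lemma laurent_poly_identity:
  assumes "laurent_poly F" "F fls_X = 0 \<or> F (Psi \<epsilon>) = 0" "\<xi> \<noteq> 0"
  shows "F \<xi> = 0"
proof -
  obtain M q where q: "\<And>\<xi>. \<xi> \<noteq> 0 \<Longrightarrow> \<xi> ^ M * F \<xi> = ev \<xi> q"
    using assms(1) unfolding laurent_poly_def by blast
  have "q = 0"
    using assms(2) q[of fls_X] q[of "Psi \<epsilon>"] by (auto simp: ev_X_eq_0_iff ev_Psi_eq_0_iff)
  thus ?thesis using q[OF assms(3)] assms(3) by simp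
qed

lemma ev_X_power: "ev \<xi> (monom 1 n) = \<xi> ^ n"
  by (induction n) (auto simp: monom_Suc)

lemma laurent_poly_const: "laurent_poly (\<lambda>\<xi>. fls_const c)"
  unfolding laurent_poly_def by (rule exI[of _ 0], rule exI[of _ "[:c:]"]) simp

lemma laurent_poly_powi: "laurent_poly (\<lambda>\<xi>. \<xi> powi n)"
  unfolding laurent_poly_def
proof (intro exI allI impI)
  fix \<xi> :: "complex fls" assume "\<xi> \<noteq> 0"
  hence "\<xi> ^ k * \<xi> powi n = \<xi> powi (int k + n)" for k by (simp add: power_int_add)
  hence "\<xi> ^ nat (- n) * \<xi> powi n = \<xi> powi (int (nat (- n)) + n)" .
  also have "int (nat (- n)) + n = int (nat n)" by simp
  also have "\<xi> powi int (nat n) = ev \<xi> (monom 1 (nat n))"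
    by (simp only: ev_X_power power_int_of_nat)
  finally show "\<xi> ^ nat (- n) * \<xi> powi n = ev \<xi> (monom 1 (nat n))" .
qed

lemma laurent_poly_mult:
  assumes "laurent_poly F" "laurent_poly G"
  shows "laurent_poly (\<lambda>\<xi>. F \<xi> * G \<xi>)"
proof -
  obtain M q M' q' where "\<And>\<xi>. \<xi> \<noteq> 0 \<Longrightarrow> \<xi> ^ M * F \<xi> = ev \<xi> q" "\<And>\<xi>. \<xi> \<noteq> 0 \<Longrightarrow> \<xi> ^ M' * G \<xi> = ev \<xi> q'"
    using assms unfolding laurent_poly_def by blast
  hence "\<xi> ^ (M + M') * (F \<xi> * G \<xi>) = ev \<xi> (q * q')" if "\<xi> \<noteq> 0" for \<xi>
    using that by (simp add: power_add flip: \<open>\<And>\<xi>. \<xi> \<noteq> 0 \<Longrightarrow> _ = ev \<xi> q\<close>)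
  thus ?thesis unfolding laurent_poly_def by blast
qed

lemma laurent_poly_add:
  assumes "laurent_poly F" "laurent_poly G"
  shows "laurent_poly (\<lambda>\<xi>. F \<xi> + G \<xi>)"
proof -
  obtain M q M' q' where *: "\<And>\<xi>. \<xi> \<noteq> 0 \<Longrightarrow> \<xi> ^ M * F \<xi> = ev \<xi> q" "\<And>\<xi>. \<xi> \<noteq> 0 \<Longrightarrow> \<xi> ^ M' * G \<xi> = ev \<xi> q'"
    using assms unfolding laurent_poly_def by blast
  have "\<xi> ^ (M + M') * (F \<xi> + G \<xi>) = ev \<xi> (monom 1 M' * q + monom 1 M * q')" if "\<xi> \<noteq> 0" for \<xi>
    by (simp add: ev_X_power *[OF that, symmetric] power_add algebra_simps)
  thus ?thesis unfolding laurent_poly_def by blast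
qed

lemma laurent_poly_sum:
  "(\<And>i. i \<in> A \<Longrightarrow> laurent_poly (F i)) \<Longrightarrow> laurent_poly (\<lambda>\<xi>. \<Sum>i\<in>A. F i \<xi>)"
  using laurent_poly_const[of 0]
  by (induction A rule: infinite_finite_induct) (auto intro: laurent_poly_add)

lemma laurent_poly_minus: "laurent_poly F \<Longrightarrow> laurent_poly (\<lambda>\<xi>. - F \<xi>)"
  using laurent_poly_mult[OF laurent_poly_const[of "-1"]] by simp

lemma laurent_poly_diff:
  "laurent_poly F \<Longrightarrow> laurent_poly G \<Longrightarrow> laurent_poly (\<lambda>\<xi>. F \<xi> - G \<xi>)"
  using laurent_poly_add[OF _ laurent_poly_minus] by fastforce

lemma laurent_poly_power: "laurent_poly F \<Longrightarrow> laurent_poly (\<lambda>\<xi>. F \<xi> ^ n)"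
  using laurent_poly_const[of 1] by (induction n) (auto intro: laurent_poly_mult)

lemma laurent_poly_id: "laurent_poly (\<lambda>\<xi>. \<xi>)"
  using laurent_poly_powi[of 1] by simp

lemma laurent_poly_1: "laurent_poly (\<lambda>\<xi>. 1)"
  using laurent_poly_const[of 1] by simp

lemmas laurent_poly_intros = laurent_poly_const laurent_poly_powi laurent_poly_mult laurent_poly_add
  laurent_poly_sum laurent_poly_minus laurent_poly_diff laurent_poly_power laurent_poly_id laurent_poly_1

section \<open>The rescaling \<open>z \<mapsto> x\<^sup>r z\<close>\<close>

lemma fls_X_intpow_add: "fls_X_intpow (m + n) = fls_X_intpow m * (fls_X_intpow n :: complex fls)"
  using power_int_add[of "fls_X :: complex fls" m n] by (simp only: fls_X_power_int fls_X_nonzero) simp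

lemma fls_X_intpow_1: "fls_X_intpow 1 = (fls_X :: complex fls)"
  by (simp add: fls_X_conv_shift_1)

definition rescale :: "int \<Rightarrow> complex fls \<Rightarrow> complex fls fls"
  where "rescale r q = Abs_fls (\<lambda>c. fls_const (q $$ c) * fls_X_intpow (c * r))"

lemma rescale_nth: "rescale r q $$ c = fls_const (q $$ c) * fls_X_intpow (c * r)"
  unfolding rescale_def by (rule nth_Abs_fls_lower_bound[of "fls_subdegree q"]) simp

lemma rescale_eq_0_low: "c < fls_subdegree q \<Longrightarrow> rescale r q $$ c = 0"
  by (simp add: rescale_nth)

lemma rescale_add: "rescale r (p + q) = rescale r p + rescale r q"
  by (rule fls_eqI) (simp add: rescale_nth distrib_right flip: fls_plus_const)

lemma rescale_diff: "rescale r (p - q) = rescale r p - rescale r q"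
  by (rule fls_eqI) (simp add: rescale_nth left_diff_distrib flip: fls_minus_const)

lemma rescale_1 [simp]: "rescale r 1 = 1"
  by (rule fls_eqI) (simp add: rescale_nth)

lemma rescale_0 [simp]: "rescale r 0 = 0"
  by (rule fls_eqI) (simp add: rescale_nth)

lemma rescale_mult: "rescale r (p * q) = rescale r p * rescale r q"
proof (rule fls_eqI)
  fix c
  let ?S = "{fls_subdegree p..c - fls_subdegree q}"
  have "(rescale r p * rescale r q) $$ c = (\<Sum>i\<in>?S. rescale r p $$ i * rescale r q $$ (c - i))"
    by (rule fls_times_nth_sum) (simp_all add: rescale_eq_0_low)
  also have "\<dots> = (\<Sum>i\<in>?S. fls_const (p $$ i * q $$ (c - i)) * fls_X_intpow (c * r))"
  proof (rule sum.cong)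
    fix i
    have "fls_X_intpow (i * r) * fls_X_intpow ((c - i) * r) = (fls_X_intpow (c * r) :: complex fls)"
      by (simp only: fls_X_intpow_add[symmetric]) (simp add: algebra_simps)
    thus "rescale r p $$ i * rescale r q $$ (c - i) = fls_const (p $$ i * q $$ (c - i)) * fls_X_intpow (c * r)"
      by (simp only: rescale_nth fls_const_mult_const[symmetric]) (simp only: mult_ac)
  qed simp
  also have "\<dots> = fls_const (\<Sum>i\<in>?S. p $$ i * q $$ (c - i)) * fls_X_intpow (c * r)"
  proof -
    have "fls_const (sum f A) = (\<Sum>x\<in>A. fls_const (f x :: complex))" for f and A :: "int set"
      by (induction A rule: infinite_finite_induct) (auto simp flip: fls_plus_const)
    thus ?thesis by (simp add: sum_distrib_right)
  qed
  also have "(\<Sum>i\<in>?S. p $$ i * q $$ (c - i)) = (p * q) $$ c"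
    by (rule fls_times_nth_sum[symmetric]) simp_all
  finally show "rescale r (p * q) $$ c = (rescale r p * rescale r q) $$ c"
    by (simp add: rescale_nth)
qed

lemma rescale_inverse: "rescale r (inverse q) = inverse (rescale r q)"
proof (cases "q = 0")
  case False
  hence "rescale r q * rescale r (inverse q) = 1" by (simp flip: rescale_mult)
  thus ?thesis by (simp add: inverse_unique)
qed simp

lemma rescale_power: "rescale r (q ^ n) = rescale r q ^ n"
  by (induction n) (simp_all add: rescale_mult)

lemma rescale_powi: "rescale r (q powi n) = rescale r q powi n"
  by (simp add: power_int_def rescale_power rescale_inverse)

lemma rescale_X: "rescale 0 fls_X = fls_X"
  by (rule fls_eqI) (simp add: rescale_nth)

lemma rescale_of_int: "rescale r (of_int k) = of_int k"
  by (rule fls_eqI) (simp add: rescale_nth fls_of_int_nth fls_of_int)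

text \<open>Such a series is homogeneous: each power of z occurs with exactly one power of x. This
  is what later collapses double sums to sums along a line.\<close>

lemma ser2_rescale:
  "ser2 (fls_const (fls_X_intpow m) * rescale r q) (c, b) = (if b = m + c * r then q $$ c else 0)"
  by (simp add: ser2_def rescale_nth fls_X_intpow_times_conv_shift)

lemma const_X_powi: "(fls_const (fls_X_intpow m) * rescale r q) powi n
    = fls_const (fls_X_intpow (m * n) :: complex fls) * rescale r (q powi n)"
  by (simp add: power_int_mult_distrib rescale_powi power_int_mult flip: fls_const_power_int fls_X_power_int)

section \<open>\<phi> and f as monomials times rescaled one-variable series\<close>

lemma xpow_deriv_iterate:
  "(xpow_deriv \<epsilon> ^^ n) fls_X
    = fls_const (\<Prod>i<n. 1 + of_int (\<epsilon> - 1) * of_nat i) * fls_X_intpow (1 + int n * (\<epsilon> - 1))"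
proof (induction n)
  case (Suc n)
  let ?a = "\<Prod>i<n. 1 + of_int (\<epsilon> - 1) * of_nat i :: complex" and ?k = "1 + int n * (\<epsilon> - 1)"
  have "(xpow_deriv \<epsilon> ^^ Suc n) fls_X = fls_X powi \<epsilon> * (fls_const ?a * (of_int ?k * fls_X powi (?k - 1)))"
    by (simp only: funpow.simps o_apply Suc.IH xpow_deriv_def fls_X_power_int[symmetric])
       (simp add: fls_deriv_powi del: fls_X_power_int)
  also have "\<dots> = fls_const (?a * of_int ?k) * (fls_X powi \<epsilon> * fls_X powi (?k - 1))"
    by (simp only: fls_of_int fls_const_mult_const[symmetric] mult_ac)
  also have "fls_X powi \<epsilon> * fls_X powi (?k - 1) = (fls_X_intpow (1 + int (Suc n) * (\<epsilon> - 1)) :: complex fls)"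
    by (simp only: fls_X_power_int fls_X_intpow_add[symmetric]) (simp add: algebra_simps)
  also have "?a * of_int ?k = (\<Prod>i<Suc n. 1 + of_int (\<epsilon> - 1) * of_nat i)" by simp
  finally show ?case .
qed (simp add: fls_X_conv_shift_1)

lemma phi_eq: "phi \<epsilon> = fls_const fls_X * rescale (\<epsilon> - 1) (Psi \<epsilon>)"
proof (rule fls_eqI)
  fix c
  show "phi \<epsilon> $$ c = (fls_const fls_X * rescale (\<epsilon> - 1) (Psi \<epsilon>)) $$ c"
  proof (cases "c < 0")
    case False
    let ?a = "\<Prod>i<nat c. 1 + of_int (\<epsilon> - 1) * of_nat i :: complex"
    have X: "fls_X_intpow (1 + c * (\<epsilon> - 1)) = fls_X * (fls_X_intpow (c * (\<epsilon> - 1)) :: complex fls)"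
      using power_int_add[of "fls_X :: complex fls" 1 "c * (\<epsilon> - 1)"] by simp
    have "phi \<epsilon> $$ c = fls_const (1 / fact (nat c)) * (fls_const ?a * fls_X_intpow (1 + c * (\<epsilon> - 1)))"
      using False by (simp add: phi_def xpow_deriv_iterate)
    also have "\<dots> = fls_const (1 / fact (nat c) * ?a) * (fls_X * fls_X_intpow (c * (\<epsilon> - 1)))"
      unfolding X by (simp only: fls_const_mult_const[symmetric] mult_ac)
    also have "\<dots> = (fls_const fls_X * rescale (\<epsilon> - 1) (Psi \<epsilon>)) $$ c"
      using False by (simp add: rescale_nth psi_def mult_ac)
    finally show ?thesis .
  qed (simp add: phi_def rescale_nth)
qed

lemma ser2_phi_powi:
  "ser2 (phi \<epsilon> powi m) (c, b) = (if b = m + c * (\<epsilon> - 1) then (Psi \<epsilon> powi m) $$ c else 0)"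
proof -
  have "phi \<epsilon> powi m = fls_const (fls_X_intpow m) * rescale (\<epsilon> - 1) (Psi \<epsilon> powi m)"
    using const_X_powi[of 1 "\<epsilon> - 1" "Psi \<epsilon>" m] by (simp only: phi_eq fls_X_intpow_1 mult_1)
  thus ?thesis by (simp only: ser2_rescale)
qed

lemma ser2_phi_diff_power:
  "ser2 ((phi \<epsilon> - fls_const fls_X) ^ k) (c, b)
    = (if b = int k + c * (\<epsilon> - 1) then ((Psi \<epsilon> - 1) ^ k) $$ c else 0)"
proof -
  have "phi \<epsilon> - fls_const fls_X = fls_const (fls_X_intpow 1) * rescale (\<epsilon> - 1) (Psi \<epsilon> - 1)"
    by (simp only: phi_eq rescale_diff right_diff_distrib fls_X_intpow_1 rescale_1 mult_1_right)
  hence "(phi \<epsilon> - fls_const fls_X) ^ k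
      = fls_const (fls_X_intpow (int k)) * rescale (\<epsilon> - 1) ((Psi \<epsilon> - 1) ^ k)"
    using const_X_powi[of 1 "\<epsilon> - 1" "Psi \<epsilon> - 1" "int k"] by (simp only: power_int_of_nat mult_1)
  thus ?thesis by (simp only: ser2_rescale)
qed

lemma g_eps_eq:
  assumes "\<epsilon> \<noteq> 1"
  shows "fps_to_fls (g_eps \<epsilon>) = ((1 + fls_X) powi (1 - \<epsilon>) - 1) / of_int (1 - \<epsilon>)"
proof -
  let ?s = "of_int (1 - \<epsilon>) :: complex"
  have "fps_const ?s * g_eps \<epsilon> = fps_binomial ?s - 1"
  proof (rule fps_eq_if_fls_deriv_eq)
    have "fls_deriv (fps_to_fls (fps_binomial ?s - 1)) = fls_deriv ((1 + fls_X) powi (1 - \<epsilon>))"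
      by (simp only: fps_to_fls_minus fps_one_to_fls fls_deriv_sub fls_deriv_one diff_0_right one_plus_fls_X_powi_eq)
    also have "\<dots> = of_int (1 - \<epsilon>) * (1 + fls_X) powi (- \<epsilon>)"
      by (subst fls_deriv_powi) (auto simp: fls_eq_iff intro!: exI[of _ 0])
    also have "\<dots> = fls_deriv (fps_to_fls (fps_const ?s * g_eps \<epsilon>))"
      by (simp add: fls_deriv_fps_to_fls fls_times_fps_to_fls g_eps_deriv fls_of_int del: of_int_diff)
    finally show "fls_deriv (fps_to_fls (fps_const ?s * g_eps \<epsilon>)) = fls_deriv (fps_to_fls (fps_binomial ?s - 1))" ..
  qed simp
  hence "fps_to_fls (fps_const ?s * g_eps \<epsilon>) = (1 + fls_X) powi (1 - \<epsilon>) - 1"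
    by (simp only: one_plus_fls_X_powi_eq fps_to_fls_minus fps_one_to_fls)
  hence "of_int (1 - \<epsilon>) * fps_to_fls (g_eps \<epsilon>) = (1 + fls_X) powi (1 - \<epsilon>) - 1"
    by (simp add: fls_times_fps_to_fls fls_of_int del: of_int_diff)
  moreover have "of_int (1 - \<epsilon>) \<noteq> (0 :: complex fls)"
    unfolding of_int_eq_0_iff using assms by simp
  ultimately show ?thesis by (simp add: nonzero_eq_divide_eq mult.commute del: of_int_diff)
qed

lemma f_eps_eq: "f_eps \<epsilon> = fls_const (fls_X_intpow (1 - \<epsilon>)) * rescale 0 (fps_to_fls (g_eps \<epsilon>))"
proof (cases "\<epsilon> = 1")
  case True
  have "fps_to_fls (fps_ln 1) = rescale 0 (fps_to_fls (g_eps 1))"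
  proof (rule fls_eqI)
    fix c
    show "fps_to_fls (fps_ln 1) $$ c = rescale 0 (fps_to_fls (g_eps 1)) $$ c"
    proof (cases "c \<le> 0")
      case False
      then obtain n where c: "c = int (Suc n)" by (metis not_le zero_less_imp_eq_int gr0_implies_Suc)
      have "fls_const ((-1) ^ n / of_nat (Suc n)) = (-1) ^ n / (of_nat (Suc n) :: complex fls)"
        by (simp add: fls_const_divide_const[symmetric] fls_const_power fls_of_nat del: of_nat_Suc)
      moreover have "((-1 :: complex) gchoose n) = (-1) ^ n"
        using gbinomial_minus[of "1 :: complex" n] by (simp flip: binomial_gbinomial)
      ultimately show ?thesis
        by (simp add: c rescale_nth g_eps_def fps_ln_def fps_integral_def nat_add_distrib field_simps
              del: of_nat_Suc)
    qed (auto simp: rescale_nth fps_ln_def)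
  qed
  thus ?thesis by (simp add: f_eps_def True)
next
  case False
  thus ?thesis
    by (simp add: f_eps_def g_eps_eq divide_inverse rescale_mult rescale_inverse rescale_diff rescale_powi
          rescale_add rescale_X rescale_of_int del: of_int_diff)
qed

lemma ser2_f_eps_powi:
  "ser2 (f_eps \<epsilon> powi m) (c, b)
    = (if b = m * (1 - \<epsilon>) then (fps_to_fls (g_eps \<epsilon>) powi m) $$ c else 0)"
  using ser2_rescale[of "(1 - \<epsilon>) * m" 0 "fps_to_fls (g_eps \<epsilon>) powi m" c b]
  by (simp only: f_eps_eq const_X_powi mult.commute[of "1 - \<epsilon>"]) simp

lemma ser2_one_plus_X_powi:
  "ser2 ((1 + fls_X) powi n) (c, b) = (if b = 0 then ((1 + fls_X) powi n) $$ c else 0)"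
  using ser2_rescale[of 0 0 "(1 + fls_X) powi n" c b]
  by (simp add: rescale_powi rescale_add rescale_X)

section \<open>Series on a line of constant total degree\<close>

lemma not_on_line: "x \<notin> range (\<lambda>j. (n - j, j)) \<Longrightarrow> fst x + snd x \<noteq> (n :: int)"
  by (cases x) (auto simp: image_iff)

text \<open>In the applications the series \<open>p m\<close> are homogeneous, so at fixed exponents
  only one total degree \<open>d\<close> of \<open>F\<close> contributes.\<close>

lemma fsubst_line:
  assumes "\<And>m n. m + n \<noteq> d \<Longrightarrow> s (p m (c, b - n)) (F (m, n)) = 0"
  shows "fsubst s p F (c, b) = Sum_any (\<lambda>n. s (p (d - n) (c, b - n)) (F (d - n, n)))"
proof -
  have "fsubst s p F (c, b) = Sum_any (\<lambda>x. s (p (fst x) (c, b - snd x)) (F x))"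
    by (simp add: fsubst_def split_def)
  also have "\<dots> = Sum_any (\<lambda>n. s (p (fst (d - n, n)) (c, b - snd (d - n, n))) (F (d - n, n)))"
  proof (rule Sum_any_reindex)
    show "inj (\<lambda>n. (d - n, n))" by (rule injI) simp
    fix x :: "int \<times> int" assume "x \<notin> range (\<lambda>n. (d - n, n))"
    thus "s (p (fst x) (c, b - snd x)) (F x) = 0"
      using assms[of "fst x" "snd x"] not_on_line by auto
  qed
  finally show ?thesis by simp
qed

lemma linear_zero: "Vector_Spaces.linear s t f \<Longrightarrow> f 0 = 0"
proof -
  assume "Vector_Spaces.linear s t f"
  then interpret Vector_Spaces.linear s t f .
  show ?thesis by (rule zero)
qed

lemma functional_compose:
  assumes "Vector_Spaces.linear s t f" "functional t \<mu>"
  shows "functional s (\<lambda>x. \<mu> (f x))"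
proof -
  interpret Vector_Spaces.linear s t f by fact
  show ?thesis
    using assms(2) by (simp add: functional_def add scale)
qed

lemma fmul_binom_pow:
  assumes "vector_space s" "c \<noteq> 0"
  shows "fmul s (binom_pow c n) F (a, b)
    = Sum_any (\<lambda>j. s (((1 + fls_const c * fls_X) powi n) $$ j) (F (a - n + j, b - j)))"
proof -
  interpret vector_space s by fact
  have "fmul s (binom_pow c n) F (a, b)
      = Sum_any (\<lambda>j. s (binom_pow c n (n - j, j)) (F ((a, b) - (n - j, j))))"
    unfolding fmul_def
  proof (rule Sum_any_reindex)
    show "inj (\<lambda>j. (n - j, j))" by (rule injI) simp
    fix x :: "int \<times> int" assume "x \<notin> range (\<lambda>j. (n - j, j))"
    hence "fst x + snd x \<noteq> n" by (rule not_on_line)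
    thus "s (binom_pow c n x) (F ((a, b) - x)) = 0"
      by (simp add: binom_pow_def split_beta)
  qed
  also have "\<dots> = Sum_any (\<lambda>j. s (((1 + fls_const c * fls_X) powi n) $$ j) (F (a - n + j, b - j)))"
  proof (rule Sum_any.cong)
    fix j
    have "binom_pow c n (n - j, j) = ((1 + fls_const c * fls_X) powi n) $$ j"
      using assms(2) by (simp add: binom_pow_def one_plus_cX_powi_nth)
    moreover have "(a, b) - (n - j, j) = (a - n + j, b - j)" by simp
    ultimately show "s (binom_pow c n (n - j, j)) (F ((a, b) - (n - j, j)))
        = s (((1 + fls_const c * fls_X) powi n) $$ j) (F (a - n + j, b - j))" by (simp only:)
  qed
  finally show ?thesis .
qed

text \<open>On a line, multiplication by a power of \<open>x\<^sub>1 + c x\<^sub>2\<close> is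
  multiplication of Laurent series in \<open>x\<^sub>2 / x\<^sub>1\<close>. The bound
  \<open>N\<close> on that line keeps the sums finite; with infinite support \<open>Sum_any\<close>
  would return 0.\<close>

lemma functional_fmul_binom_pow:
  assumes "vector_space s" "c \<noteq> 0" "functional s \<mu>"
    and low: "\<And>j. j < N \<Longrightarrow> F (a + b - n - j, j) = 0"
  shows "\<mu> (fmul s (binom_pow c n) F (a, b))
    = ((1 + fls_const c * fls_X) powi n * Abs_fls (\<lambda>j. \<mu> (F (a + b - n - j, j)))) $$ b"
proof -
  interpret vector_space s by fact
  let ?B = "(1 + fls_const c * fls_X) powi n :: complex fls"
  have F: "F (a - n + j, b - j) = F (a + b - n - (b - j), b - j)" for j
    by (simp add: algebra_simps)
  have fin: "finite {j. s (?B $$ j) (F (a + b - n - (b - j), b - j)) \<noteq> 0}"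
  proof (rule finite_support_int[of 0 _ "b - N"])
    show "s (?B $$ j) (F (a + b - n - (b - j), b - j)) = 0" if "j < 0" for j
      using that assms(2) by (simp add: one_plus_cX_powi_nth)
    show "s (?B $$ j) (F (a + b - n - (b - j), b - j)) = 0" if "j > b - N" for j
      using that by (subst low) auto
  qed
  have "\<mu> (fmul s (binom_pow c n) F (a, b)) = Sum_any (\<lambda>j. ?B $$ j * \<mu> (F (a + b - n - (b - j), b - j)))"
    unfolding fmul_binom_pow[OF assms(1,2)] F functional_Sum_any[OF assms(3) fin]
    by (simp only: functional_scale[OF assms(3)])
  moreover have "laurent1 (\<lambda>j. \<mu> (F (a + b - n - j, j)))"
    unfolding laurent1_def by (intro exI[of _ N]) (simp add: low functional_0[OF assms(3)])
  hence "Sum_any (\<lambda>j. ?B $$ j * \<mu> (F (a + b - n - (b - j), b - j)))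
      = (?B * Abs_fls (\<lambda>j. \<mu> (F (a + b - n - j, j)))) $$ b"
    by (simp add: fls_times_Sum_any laurent1_nth)
  ultimately show ?thesis by simp
qed

text \<open>For a nonnegative exponent both expansions are the same polynomial, so exchanging the
  variables only costs a sign.\<close>

lemma binom_pow_swap:
  "binom_pow (-1) (int k) (prod.swap x) = (-1) ^ k * binom_pow (-1) (int k) x"
proof -
  obtain a b where x: "x = (a, b)" by (cases x)
  have *: "(of_nat k gchoose nat i) = (0 :: complex)" if "i > int k" for i
    using that by (simp add: binomial_eq_0 flip: binomial_gbinomial)
  show ?thesis
  proof (cases "a + b = int k \<and> a \<ge> 0 \<and> b \<ge> 0")
    case True
    hence k: "k = nat a + nat b" by linarith
    have "nat a + nat b - nat a = nat b" by simp
    hence "(k choose nat a) = (k choose nat b)"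
      using binomial_symmetric[of "nat a" k] by (simp add: k)
    moreover have "(- 1) ^ nat a = (- 1) ^ k * (- 1 :: complex) ^ nat b"
      by (simp add: k power_add flip: power_mult_distrib)
    ultimately show ?thesis
      using True by (simp add: x binom_pow_def add.commute flip: binomial_gbinomial)
  next
    case False
    thus ?thesis using *[of a] *[of b] by (auto simp: x binom_pow_def)
  qed
qed

lemma fmul_binom_pow_swap:
  assumes "vector_space s"
  shows "fmul s (binom_pow (-1) (int k)) (F \<circ> prod.swap) (a, b)
    = s ((-1) ^ k) (fmul s (binom_pow (-1) (int k)) F (b, a))"
proof -
  interpret vector_space s by fact
  have "fmul s (binom_pow (-1) (int k)) (F \<circ> prod.swap) (a, b)
      = Sum_any (\<lambda>i. s (binom_pow (-1) (int k) (prod.swap i)) ((F \<circ> prod.swap) ((a, b) - prod.swap i)))"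
    unfolding fmul_def by (rule Sum_any_reindex) (auto simp: inj_def)
  also have "\<dots> = Sum_any (\<lambda>i. s ((-1) ^ k) (s (binom_pow (-1) (int k) i) (F ((b, a) - i))))"
    by (intro Sum_any.cong) (auto simp: binom_pow_swap split: prod.splits)
  also have "\<dots> = s ((-1) ^ k) (fmul s (binom_pow (-1) (int k)) F (b, a))"
  proof -
    have "{i. s ((-1) ^ k) (f i) \<noteq> 0} = {i. f i \<noteq> 0}" for f :: "int \<times> int \<Rightarrow> 'a" by simp
    thus ?thesis by (simp add: fmul_def Sum_any.expand_set scale_sum_right)
  qed
  finally show ?thesis .
qed

section \<open>Skew symmetry\<close>

definition x_over_one_plus_x :: "complex fps"
  where "x_over_one_plus_x = fps_X * inverse (1 + fps_X)"

lemma x_over_one_plus_x: "x_over_one_plus_x $ 0 = 0" "x_over_one_plus_x \<noteq> 0" "fps_to_fls x_over_one_plus_x = fls_X / (1 + fls_X)"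
proof -
  show "x_over_one_plus_x $ 0 = 0" by (simp add: x_over_one_plus_x_def)
  show e: "fps_to_fls x_over_one_plus_x = fls_X / (1 + fls_X)"
    by (simp add: x_over_one_plus_x_def fls_times_fps_to_fls divide_inverse fls_inverse_fps_to_fls flip: fps_X_to_fls fps_one_to_fls fps_to_fls_plus)
  have "x_over_one_plus_x $ 1 \<noteq> 0" by (simp add: x_over_one_plus_x_def)
  thus "x_over_one_plus_x \<noteq> 0" by auto
qed

lemma one_plus_X_nonzero: "1 + fls_X \<noteq> (0 :: complex fls)" "1 - fls_X \<noteq> (0 :: complex fls)"
  by (auto simp: fls_eq_iff intro!: exI[of _ 0])

context vertex_algebra
begin

lemma Y_0_right [simp]: "Y u 0 n = 0"
proof -
  have "Vector_Spaces.linear sV sV (\<lambda>w. Y u w n)" using Y_Hom[of u] by (simp add: in_Hom_def)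
  thus ?thesis by (rule linear_zero)
qed

definition creation_line :: "('v \<Rightarrow> complex) \<Rightarrow> int \<Rightarrow> 'v \<Rightarrow> 'v \<Rightarrow> complex fls"
  where "creation_line \<mu> d u v = Abs_fls (\<lambda>n. \<mu> (Y u (Y v vac n) (d - n)))"

lemma creation_line_nth:
  assumes "functional sV \<mu>"
  shows "creation_line \<mu> d u v $$ n = \<mu> (Y u (Y v vac n) (d - n))"
  unfolding creation_line_def
  by (rule laurent1_nth) (auto simp: laurent1_def creation_regular functional_0[OF assms] intro!: exI[of _ 0])

text \<open>
  \<open>Y(Y(u, x\<^sub>0) v, x\<^sub>2) \<one> = Y(u, x\<^sub>0 + x\<^sub>2) Y(v, x\<^sub>2) \<one>\<close>, where \<open>x\<^sub>2 / x\<^sub>1\<close> becomes \<open>x / (1 + x)\<close> for \<open>x = x\<^sub>2 / x\<^sub>0\<close>.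
\<close>

lemma iterate_vac:
  assumes \<mu>: "functional sV \<mu>"
  shows "\<mu> (Y (Y u v (d - b)) vac b)
    = ((1 + fls_X) powi d * fls_compose_fps (creation_line \<mu> d u v) x_over_one_plus_x) $$ b"
proof -
  let ?L = "1 + fls_X :: complex fls"
  let ?F = "fsubst sV (binom_pow 1) (Yprod Y u v vac)"
  let ?G = "Yiter Y Y u v vac"
  note vs = vector_space_axioms
  obtain l where l: "fmul sV (binom_pow 1 (int l)) ?F = fmul sV (binom_pow 1 (int l)) ?G"
    using weak_associativity by blast
  have F: "?F (d - b, b) = Sum_any (\<lambda>n. sV ((?L powi (d - n)) $$ (b - n)) (Y u (Y v vac n) (d - n)))" for b
  proof -
    have "?F (d - b, b) = Sum_any (\<lambda>n. sV (binom_pow 1 (d - n) (d - b, b - n)) (Yprod Y u v vac (d - n, n)))"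
      by (rule fsubst_line) (simp add: binom_pow_def)
    also have "\<dots> = Sum_any (\<lambda>n. sV ((?L powi (d - n)) $$ (b - n)) (Y u (Y v vac n) (d - n)))"
      using one_plus_cX_powi_nth[of 1]
      by (intro Sum_any.cong) (simp add: binom_pow_def Yprod_def)
    finally show ?thesis .
  qed
  \<comment> \<open>Creation bounds \<open>n\<close> below by 0 and the binomial expansion bounds it
    above by \<open>b\<close>, so these sums are finite and both series start at exponent 0.\<close>
  have zero: "sV ((?L powi (d - n)) $$ (b - n)) (Y u (Y v vac n) (d - n)) = 0" if "n < 0 \<or> n > b" for b n
    using that one_plus_cX_powi_nth[of 1 "d - n" "b - n"] by (auto simp: creation_regular)
  have F0: "?F (d - b, b) = 0" if "b < 0" for b
  proof -
    have "sV ((?L powi (d - n)) $$ (b - n)) (Y u (Y v vac n) (d - n)) = 0" for n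
      using that by (intro zero) linarith
    thus ?thesis unfolding F by (simp only: Sum_any.neutral)
  qed
  have G0: "?G (d - b, b) = 0" if "b < 0" for b
    using that by (simp add: Yiter_def creation_regular)
  have "?L powi int l * Abs_fls (\<lambda>j. \<mu> (?F (d - j, j))) = ?L powi int l * Abs_fls (\<lambda>j. \<mu> (?G (d - j, j)))"
  proof (rule fls_eqI)
    fix b
    have e: "d + int l - b + b - int l - j = d - j" for j by simp
    have "\<mu> (fmul sV (binom_pow 1 (int l)) ?F (d + int l - b, b))
        = ((1 + fls_const 1 * fls_X) powi int l * Abs_fls (\<lambda>j. \<mu> (?F (d + int l - b + b - int l - j, j)))) $$ b"
      by (rule functional_fmul_binom_pow[OF vs _ \<mu>, of _ 0]) (simp_all add: e F0)
    moreover have "\<mu> (fmul sV (binom_pow 1 (int l)) ?G (d + int l - b, b))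
        = ((1 + fls_const 1 * fls_X) powi int l * Abs_fls (\<lambda>j. \<mu> (?G (d + int l - b + b - int l - j, j)))) $$ b"
      by (rule functional_fmul_binom_pow[OF vs _ \<mu>, of _ 0]) (simp_all add: e G0)
    ultimately show "(?L powi int l * Abs_fls (\<lambda>j. \<mu> (?F (d - j, j)))) $$ b
        = (?L powi int l * Abs_fls (\<lambda>j. \<mu> (?G (d - j, j)))) $$ b"
      by (simp add: e l)
  qed
  \<comment> \<open>Being bounded below, both sides lie in a field of Laurent series, so the power
    of 1 + x cancels.\<close>
  hence eq: "Abs_fls (\<lambda>j. \<mu> (?F (d - j, j))) = Abs_fls (\<lambda>j. \<mu> (?G (d - j, j)))"
    using one_plus_X_nonzero by simp
  have "laurent1 (\<lambda>j. \<mu> (?F (d - j, j)))" "laurent1 (\<lambda>j. \<mu> (?G (d - j, j)))"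
    by (auto simp: laurent1_def F0 G0 functional_0[OF \<mu>] intro!: exI[of _ 0])
  hence "\<mu> (?G (d - b, b)) = \<mu> (?F (d - b, b))"
    using arg_cong[OF eq, of "\<lambda>f. f $$ b"] by (simp only: laurent1_nth)
  also have "\<dots> = Sum_any (\<lambda>n. (?L powi (d - n)) $$ (b - n) * \<mu> (Y u (Y v vac n) (d - n)))"
  proof -
    have "finite {n. sV ((?L powi (d - n)) $$ (b - n)) (Y u (Y v vac n) (d - n)) \<noteq> 0}"
      by (rule finite_support_int[of 0 _ b]; rule zero; simp)
    thus ?thesis
      unfolding F by (simp only: functional_Sum_any[OF \<mu>] functional_scale[OF \<mu>])
  qed
  also have "\<dots> = Sum_any (\<lambda>n. creation_line \<mu> d u v $$ n * (?L powi d * fps_to_fls x_over_one_plus_x powi n) $$ b)"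
  proof (intro Sum_any.cong)
    fix n
    have "?L powi d * fps_to_fls x_over_one_plus_x powi n = fls_X powi n * (?L powi d / ?L powi n)"
      unfolding x_over_one_plus_x(3) power_int_divide_distrib by simp
    also have "\<dots> = fls_X_intpow n * ?L powi (d - n)"
      using one_plus_X_nonzero by (simp only: power_int_diff[of ?L d n] fls_X_power_int simp_thms)
    finally have "?L powi d * fps_to_fls x_over_one_plus_x powi n = fls_X_intpow n * ?L powi (d - n)" .
    hence "(?L powi d * fps_to_fls x_over_one_plus_x powi n) $$ b = (?L powi (d - n)) $$ (b - n)"
      by (simp add: fls_X_intpow_times_conv_shift)
    thus "(?L powi (d - n)) $$ (b - n) * \<mu> (Y u (Y v vac n) (d - n))
        = creation_line \<mu> d u v $$ n * (?L powi d * fps_to_fls x_over_one_plus_x powi n) $$ b"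
      by (simp add: creation_line_nth[OF \<mu>])
  qed
  also have "\<dots> = (?L powi d * fls_compose_fps (creation_line \<mu> d u v) x_over_one_plus_x) $$ b"
    by (rule fls_compose_fps_nth[symmetric]) (simp_all add: x_over_one_plus_x)
  finally show ?thesis by (simp add: Yiter_def)
qed

text \<open>Exchanging the variables reverses the line of total degree \<open>d + k\<close>. As both
  sides have no negative exponents, each is a polynomial of degree at most
  \<open>d + k\<close>.\<close>

lemma weak_commutativity_vac:
  assumes \<mu>: "functional sV \<mu>"
  obtains k where "\<And>b. ((1 - fls_X) ^ k * creation_line \<mu> d u v) $$ b
    = (-1) ^ k * ((1 - fls_X) ^ k * creation_line \<mu> d v u) $$ (d + int k - b)"
proof -
  note vs = vector_space_axioms
  obtain k where k: "fmul sV (binom_pow (-1) (int k)) (Yprod Y u v vac)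
        = fmul sV (binom_pow (-1) (int k)) (Yprod Y v u vac \<circ> prod.swap)"
    using weak_commutativity by meson
  have line: "\<mu> (fmul sV (binom_pow (-1) (int k)) (Yprod Y u v vac) (d + int k - b, b))
      = ((1 - fls_X) ^ k * creation_line \<mu> d u v) $$ b" for u v b
  proof -
    have e: "d + int k - b + b - int k - j = d - j" for j by simp
    have "\<mu> (fmul sV (binom_pow (-1) (int k)) (Yprod Y u v vac) (d + int k - b, b))
        = ((1 + fls_const (-1) * fls_X) powi int k
            * Abs_fls (\<lambda>j. \<mu> (Yprod Y u v vac (d + int k - b + b - int k - j, j)))) $$ b"
      by (rule functional_fmul_binom_pow[OF vs _ \<mu>, of _ 0]) (simp_all add: Yprod_def creation_regular)
    thus ?thesis by (simp add: e Yprod_def creation_line_def)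
  qed
  show ?thesis
  proof (rule that)
    fix b
    have "((1 - fls_X) ^ k * creation_line \<mu> d u v) $$ b
        = \<mu> (fmul sV (binom_pow (-1) (int k)) (Yprod Y v u vac \<circ> prod.swap) (d + int k - b, b))"
      by (simp only: line[symmetric] k)
    also have "\<dots> = (-1) ^ k * \<mu> (fmul sV (binom_pow (-1) (int k)) (Yprod Y v u vac) (b, d + int k - b))"
      by (simp only: fmul_binom_pow_swap[OF vs] functional_scale[OF \<mu>])
    also have "\<mu> (fmul sV (binom_pow (-1) (int k)) (Yprod Y v u vac) (b, d + int k - b))
        = ((1 - fls_X) ^ k * creation_line \<mu> d v u) $$ (d + int k - b)"
      using line[of v u "d + int k - b"] by simp
    finally show "((1 - fls_X) ^ k * creation_line \<mu> d u v) $$ b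
        = (-1) ^ k * ((1 - fls_X) ^ k * creation_line \<mu> d v u) $$ (d + int k - b)" .
  qed
qed

text \<open>This is Y(v, x) u = e^(xD) Y(u, -x) v, with e^(xD) a written as Y(a, x)
  \<open>vac\<close>. The alternating sum evaluates the iterate at
  \<open>x\<^sub>0 = - x\<^sub>2\<close>, where \<open>x\<^sub>1 = x\<^sub>0 + x\<^sub>2\<close>
  vanishes. Of the polynomial \<open>R\<close> obtained by clearing the denominator only the top
  coefficient survives, and by weak commutativity and creation this is the coefficient of Y(v, x)
  u.\<close>

lemma skew_symmetry:
  assumes \<mu>: "functional sV \<mu>"
  shows "\<mu> (Y v u d) = Sum_any (\<lambda>i. (-1) powi (d - i) * \<mu> (Y (Y u v (d - i)) vac i))"
proof -
  let ?y = "creation_line \<mu> d u v" and ?y' = "creation_line \<mu> d v u" and ?h = x_over_one_plus_x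
  obtain k where k: "\<And>b. ((1 - fls_X) ^ k * ?y) $$ b
      = (-1) ^ k * ((1 - fls_X) ^ k * ?y') $$ (d + int k - b)"
    using weak_commutativity_vac[OF \<mu>] by blast
  define R where "R = (1 - fls_X) ^ k * ?y"
  define D where "D = nat (d + int k)"
  have low: "((1 - fls_X) ^ k * creation_line \<mu> d u v) $$ b = 0" if "b < 0" for b u v
  proof -
    have 1: "((1 - fls_X) ^ k :: complex fls) = fps_to_fls ((1 - fps_X) ^ k)"
      by (simp add: fps_to_fls_power)
    have "((1 - fls_X) ^ k * creation_line \<mu> d u v) $$ b = (\<Sum>i\<in>{0..b-0}.
        ((1 - fls_X) ^ k) $$ i * creation_line \<mu> d u v $$ (b - i))"
      by (rule fls_times_nth_sum) (simp_all add: 1 creation_line_nth[OF \<mu>] creation_regular functional_0[OF \<mu>])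
    thus ?thesis using that by simp
  qed
  have zero: "((1 - fls_X) ^ k * creation_line \<mu> d v u) $$ 0 = creation_line \<mu> d v u $$ 0" for u v
  proof -
    have 1: "((1 - fls_X) ^ k :: complex fls) = fps_to_fls ((1 - fps_X) ^ k)"
      by (simp add: fps_to_fls_power)
    have "((1 - fls_X) ^ k * creation_line \<mu> d v u) $$ 0 = (\<Sum>i\<in>{0..0-0}.
        ((1 - fls_X) ^ k) $$ i * creation_line \<mu> d v u $$ (0 - i))"
      by (rule fls_times_nth_sum) (simp_all add: 1 creation_line_nth[OF \<mu>] creation_regular functional_0[OF \<mu>])
    thus ?thesis by (simp add: 1 fps_nth_power_0)
  qed
  have R0: "R $$ b = 0" if "b < 0 \<or> b > d + int k" for b
    using that low[of b] low[of "d + int k - b"] k[of b] by (auto simp: R_def)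
  have Rtop: "R $$ (d + int k) = (-1) ^ k * \<mu> (Y v u d)"
    using k[of "d + int k"] by (simp add: R_def zero creation_line_nth[OF \<mu>] creation_limit)
  have R: "R = (\<Sum>b\<in>{0..d + int k}. fls_const (R $$ b) * fls_X powi b)"
  proof (rule fls_eqI)
    fix b
    have "(\<Sum>b\<in>{0..d + int k}. fls_const (R $$ b) * fls_X powi b) $$ b
        = (\<Sum>i\<in>{0..d + int k}. if i = b then R $$ i else 0)"
      unfolding fls_nth_sum by (intro sum.cong) auto
    thus "R $$ b = (\<Sum>b\<in>{0..d + int k}. fls_const (R $$ b) * fls_X powi b) $$ b"
      using R0[of b] by auto
  qed
  let ?L = "1 + fls_X :: complex fls"
  have hL: "1 - fps_to_fls ?h = inverse ?L"
    using one_plus_X_nonzero by (simp add: x_over_one_plus_x field_simps)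
  have "fls_compose_fps R ?h = inverse ?L ^ k * fls_compose_fps ?y ?h"
    unfolding R_def using x_over_one_plus_x
    by (simp add: fls_compose_fps_mult fls_compose_fps_power fls_compose_fps_diff hL[unfolded x_over_one_plus_x])
  hence "?L powi d * fls_compose_fps ?y ?h = ?L powi (d + int k) * fls_compose_fps R ?h"
    using one_plus_X_nonzero by (simp add: power_int_add field_simps)
  also have "\<dots> = (\<Sum>b\<in>{0..d + int k}. fls_const (R $$ b) * (fls_X ^ nat b * ?L ^ (D - nat b)))"
  proof -
    have "fls_compose_fps R ?h = (\<Sum>b\<in>{0..d + int k}. fls_const (R $$ b) * (fls_X / ?L) powi b)"
      by (subst R, subst fls_compose_fps_sum[OF x_over_one_plus_x(1,2)])
        (simp add: fls_compose_fps_mult fls_compose_fps_powi x_over_one_plus_x del: fls_X_power_int)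
    moreover have "?L powi (d + int k) * (fls_X / ?L) powi b = fls_X ^ nat b * ?L ^ (D - nat b)"
      if "b \<in> {0..d + int k}" for b
    proof -
      have "?L powi (d + int k) * (fls_X / ?L) powi b = fls_X powi b * ?L powi (d + int k - b)"
        using one_plus_X_nonzero by (simp add: power_int_divide_distrib power_int_diff)
      moreover have "d + int k - b = int (D - nat b)" using that by (auto simp: D_def)
      ultimately show ?thesis using that by (simp add: power_int_def del: fls_X_power_int)
    qed
    ultimately show ?thesis
      by (simp only: sum_distrib_left mult.left_commute[of "?L powi (d + int k)"] cong: sum.cong)
  qed
  also have "\<dots> = fps_to_fls (fps_of_poly (\<Sum>b\<in>{0..d + int k}. smult (R $$ b) (monom 1 (nat b) * [:1, 1:] ^ (D - nat b))))"
    (is "_ = fps_to_fls (fps_of_poly ?P)")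
  proof -
    have s: "fps_to_fls (sum f A) = (\<Sum>b\<in>A. fps_to_fls (f b))" for f :: "int \<Rightarrow> complex fps" and A
      by (induction A rule: infinite_finite_induct) auto
    show ?thesis
      by (simp add: fps_of_poly_sum s fps_of_poly_smult fps_of_poly_mult fps_of_poly_monom fps_of_poly_power
           fls_times_fps_to_fls fps_to_fls_power fps_of_poly_pCons)
  qed
  finally have H: "?L powi d * fls_compose_fps ?y ?h = fps_to_fls (fps_of_poly ?P)" .
  have "Sum_any (\<lambda>i. (-1) powi (d - i) * \<mu> (Y (Y u v (d - i)) vac i))
      = Sum_any (\<lambda>i. (-1) powi (d - i) * fps_to_fls (fps_of_poly ?P) $$ i)"
    by (simp only: iterate_vac[OF \<mu>] H)
  also have "\<dots> = Sum_any (\<lambda>i::nat. (-1) powi (d - int i) * fps_to_fls (fps_of_poly ?P) $$ int i)"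
    by (rule Sum_any_reindex) (auto simp: inj_def image_iff, metis nat_0_le not_le)
  also have "\<dots> = Sum_any (\<lambda>i::nat. (-1) powi d * (coeff ?P i * (-1) ^ i))"
    by (intro Sum_any.cong) (simp add: power_int_diff field_simps)
  also have "\<dots> = (\<Sum>i\<le>degree ?P. (-1) powi d * (coeff ?P i * (-1) ^ i))"
    by (rule Sum_any.expand_superset) (auto intro: le_degree)
  also have "\<dots> = (-1) powi d * poly ?P (-1)"
    by (simp add: poly_altdef sum_distrib_left)
  \<comment> \<open>The factor 1 + x vanishes at -1, which leaves only the summand
    \<open>b = d + k\<close>.\<close>
  also have "poly ?P (-1) = (\<Sum>b\<in>{0..d + int k}. R $$ b * ((-1) ^ nat b * 0 ^ (D - nat b)))"
    by (simp add: poly_sum poly_monom)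
  also have "\<dots> = (\<Sum>b\<in>{0..d + int k}. if b = d + int k then R $$ b * (-1) powi b else 0)"
    by (intro sum.cong) (auto simp: D_def power_0_left power_int_def)
  \<comment> \<open>If \<open>d + k\<close> is negative, the index set is empty and this coefficient
    of \<open>R\<close> is zero as well.\<close>
  also have "\<dots> = R $$ (d + int k) * (-1) powi (d + int k)"
    using R0[of "d + int k"] by auto
  also have "(-1) powi d * (R $$ (d + int k) * (-1) powi (d + int k)) = \<mu> (Y v u d)"
  proof -
    have "(-1) powi d * (-1) powi d = (1 :: complex)" "(-1) ^ k * (-1) ^ k = (1 :: complex)"
      by (simp_all flip: power_int_mult_distrib power_mult_distrib)
    moreover have "x * (y * m * (x * y)) = (x * x) * (y * y) * m" for x y m :: complex
      by (simp only: mult_ac)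
    moreover have "(-1) powi (d + int k) = (-1) powi d * (-1 :: complex) ^ k"
      by (simp add: power_int_add)
    ultimately show ?thesis unfolding Rtop by (simp only: mult_1)
  qed
  finally show ?thesis ..
qed

end

section \<open>Delta functions and residues\<close>

lemma one_minus_X_powi_nth:
  "((1 - fls_X) powi n) $$ j = (if j \<ge> 0 then (of_int n gchoose nat j) * (-1) ^ nat j else (0::complex))"
  using one_plus_cX_powi_nth[of "-1" n j] by simp

lemma one_plus_X_powi_nth:
  "((1 + fls_X) powi n) $$ j = (if j \<ge> 0 then (of_int n gchoose nat j) else (0::complex))"
  using one_plus_cX_powi_nth[of 1 n j] by simp

lemma gbinomial_minus_Suc: "((- of_nat r - 1 :: complex) gchoose j) = (-1) ^ j * of_nat ((r + j) choose j)"
proof -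
  have "((- of_nat r - 1 :: complex) gchoose j) = (- (of_nat (Suc r)) gchoose j)"
    by (simp only: of_nat_Suc minus_add_distrib diff_conv_add_uminus add.commute)
  also have "\<dots> = (-1) ^ j * ((of_nat (Suc r) + of_nat j - 1) gchoose j)"
    by (rule gbinomial_minus)
  also have "of_nat (Suc r) + of_nat j - 1 = (of_nat (r + j) :: complex)" by simp
  finally show ?thesis by (simp only: binomial_gbinomial)
qed

text \<open>The three-term delta function identity, read off at
  \<open>x\<^sub>1^e x\<^sub>2^(-e-1) z^(-m-1)\<close>. For \<open>m\<close> nonnegative the two
  expansions agree and the right side has no such power of z. For \<open>m\<close> negative at most
  one expansion contributes, depending on the sign of \<open>e\<close>, and the symmetry of binomial
  coefficients remains.\<close>

lemma delta_identity:
  "((1 - fls_X) powi m) $$ (m - e) - (-1) powi m * ((1 - fls_X) powi m) $$ e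
    = (((1 + fls_X) powi (- e - 1)) $$ (- m - 1) :: complex)"
proof (cases "m \<ge> 0")
  case True
  then obtain n where m: "m = int n" by (metis zero_le_imp_eq_int)
  have big: "(of_nat n gchoose nat i) = (0 :: complex)" if "i > m" for i
    using that by (simp add: m binomial_eq_0 flip: binomial_gbinomial)
  show ?thesis
  proof (cases "0 \<le> e \<and> e \<le> m")
    case True
    then obtain i where e: "e = int i" "i \<le> n" by (metis m zero_le_imp_eq_int of_nat_le_iff)
    have "(-1) ^ (n - i) = (-1 :: complex) ^ n * (-1) ^ i"
      using e(2) by (simp add: minus_one_power_iff even_diff_nat)
    moreover have "nat (int n - int i) = n - i" by simp
    ultimately show ?thesis
      unfolding one_minus_X_powi_nth one_plus_X_powi_nth
      using e binomial_symmetric[of i n]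
      by (simp add: m flip: binomial_gbinomial of_nat_diff)
  next
    case False
    thus ?thesis using big[of "m - e"] big[of e]
      unfolding one_minus_X_powi_nth one_plus_X_powi_nth by (auto simp: m)
  qed
next
  case False
  define r where "r = nat (- m - 1)"
  have m: "m = - int r - 1" using False by (simp add: r_def)
  have sgn: "(-1) powi m = (- ((-1) ^ r) :: complex)"
  proof -
    have "m = - int (Suc r)" by (simp add: m)
    hence "(-1) powi m = ((-1) powi (- int (Suc r)) :: complex)" by (simp only:)
    also have "\<dots> = (-1) ^ Suc r"
      by (simp only: power_int_minus_one_minus power_int_of_nat)
    finally show ?thesis by simp
  qed
  show ?thesis
  proof (cases "e \<ge> 0")
    case True
    then obtain s where e: "e = int s" by (metis zero_le_imp_eq_int)
    have "(s + r choose r) = (r + s choose s)"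
      using binomial_symmetric[of r "r + s"] by (simp add: add.commute)
    thus ?thesis
      unfolding sgn using gbinomial_minus_Suc[of r s] gbinomial_minus_Suc[of s r]
      by (simp add: m e one_minus_X_powi_nth one_plus_X_powi_nth)
  next
    case False
    define s where "s = nat (- e - 1)"
    have e: "e = - int s - 1" using False by (simp add: s_def)
    have rhs: "((1 + fls_X) powi (- e - 1)) $$ (- m - 1) = (of_nat (s choose r) :: complex)"
      unfolding one_plus_X_powi_nth by (simp add: m e flip: binomial_gbinomial)
    have "((1 - fls_X) powi m) $$ e = (0 :: complex)" by (simp add: e one_minus_X_powi_nth)
    moreover have "((1 - fls_X) powi m) $$ (m - e) = (of_nat (s choose r) :: complex)"
    proof (cases "s \<ge> r")
      case True
      then obtain j where s: "s = r + j" by (metis le_add_diff_inverse)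
      have "(s choose r) = (r + j choose j)"
        using binomial_symmetric[of r "r + j"] by (simp add: s)
      thus ?thesis using gbinomial_minus_Suc[of r j]
        by (simp add: m e s one_minus_X_powi_nth flip: power_mult_distrib)
    qed (simp add: m e one_minus_X_powi_nth binomial_eq_0)
    ultimately show ?thesis unfolding rhs by simp
  qed
qed

text \<open>
  Here \<open>f\<close>, \<open>f'\<close> and \<open>q\<close> are one Laurent polynomial \<open>\<Sum> R n x\<^sub>1\<^bsup>d+k-n\<^esup> x\<^sub>2\<^bsup>n\<^esup>\<close> divided by \<open>(x\<^sub>1 - x\<^sub>2)\<^sup>k\<close>, expanded
  in the domains \<open>|x\<^sub>1| > |x\<^sub>2|\<close> and \<open>|x\<^sub>2| > |x\<^sub>1|\<close>, and at \<open>x\<^sub>1 = x\<^sub>2 (1 + z)\<close>.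
\<close>

lemma jacobi_line:
  fixes f f' q :: "complex fls"
  assumes f: "(1 - fls_X) ^ k * f = (\<Sum>n\<in>S. fls_const (R n) * fls_X powi n)"
    and f': "(fls_X - 1) ^ k * f' = (\<Sum>n\<in>S. fls_const (R n) * fls_X powi (d + int k - n))"
    and q: "fls_X ^ k * q = (\<Sum>n\<in>S. fls_const (R n) * (1 + fls_X) powi (d + int k - n))"
  shows "((1 - fls_X) powi m * f) $$ (d - a + m) - (-1) powi m * ((1 - fls_X) powi m * f') $$ a
    = ((1 + fls_X) powi (- a - 1) * q) $$ (- m - 1)"
proof -
  let ?M = "1 - fls_X :: complex fls" and ?L = "1 + fls_X :: complex fls"
  note nz = one_plus_X_nonzero
  have sh: "(\<Sum>n\<in>S. fls_const (R n) * (fls_X powi h n * F n)) $$ b = (\<Sum>n\<in>S. R n * F n $$ (b - h n))" for F h b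
    by (simp add: fls_nth_sum fls_X_intpow_times_conv_shift)
  \<comment> \<open>Division by the \<open>k\<close>-th power lowers the exponent \<open>m\<close>
    to \<open>m - k\<close>, of either sign; the claim becomes a sum of delta identities, one for
    each monomial.\<close>
  have fm: "?M powi m * f = (\<Sum>n\<in>S. fls_const (R n) * (fls_X powi n * ?M powi (m - int k)))"
  proof -
    have "?M powi m * f = ?M powi (m - int k) * (?M ^ k * f)"
      using nz power_int_add[of ?M "m - int k" "int k"] by (simp add: mult.assoc)
    thus ?thesis unfolding f by (simp add: sum_distrib_left mult_ac del: fls_X_power_int)
  qed
  have f'm: "?M powi m * f' = (-1) ^ k * (\<Sum>n\<in>S. fls_const (R n) * (fls_X powi (d + int k - n) * ?M powi (m - int k)))"
  proof -
    have "(fls_X - 1) ^ k = (-1) ^ k * ?M ^ k" by (simp flip: power_mult_distrib)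
    hence "?M ^ k * f' = (-1) ^ k * ((fls_X - 1) ^ k * f')"
      by (simp flip: mult.assoc power_mult_distrib)
    moreover have "?M powi m * f' = ?M powi (m - int k) * (?M ^ k * f')"
      using nz power_int_add[of ?M "m - int k" "int k"] by (simp add: mult.assoc)
    ultimately have "?M powi m * f' = ?M powi (m - int k) * ((-1) ^ k * ((fls_X - 1) ^ k * f'))"
      by (simp only:)
    thus ?thesis unfolding f' by (simp add: sum_distrib_left mult_ac del: fls_X_power_int)
  qed
  have qm: "?L powi (- a - 1) * q
      = (\<Sum>n\<in>S. fls_const (R n) * (fls_X powi (- int k) * ?L powi (d + int k - n - a - 1)))"
  proof -
    have "q = fls_X powi (- int k) * (fls_X ^ k * q)"
      by (simp add: power_int_minus del: fls_X_power_int flip: mult.assoc)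
    hence "?L powi (- a - 1) * q = (\<Sum>n\<in>S. fls_const (R n) * (fls_X powi (- int k) * (?L powi (d + int k - n) * ?L powi (- a - 1))))"
      unfolding q by (simp only: sum_distrib_left mult_ac)
    moreover have "?L powi (d + int k - n) * ?L powi (- a - 1) = ?L powi (d + int k - n - a - 1)" for n
      using power_int_add[of ?L "d + int k - n" "- a - 1"] nz by (simp add: algebra_simps)
    ultimately show ?thesis by (simp only:)
  qed
  have neg: "((-1) ^ k * g) $$ b = (-1) ^ k * g $$ b" for g :: "complex fls" and b
    by (cases "even k") auto
  have "((1 - fls_X) powi m * f) $$ (d - a + m) - (-1) powi m * ((1 - fls_X) powi m * f') $$ a
      = (\<Sum>n\<in>S. R n * ((?M powi (m - int k)) $$ (d - a + m - n)
          - (-1) powi m * (-1) ^ k * (?M powi (m - int k)) $$ (a - (d + int k - n))))"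
    unfolding fm f'm neg sh by (simp add: sum_distrib_left sum_subtractf right_diff_distrib mult_ac)
  also have "\<dots> = (\<Sum>n\<in>S. R n * (?L powi (d + int k - n - a - 1)) $$ (- m - 1 + int k))"
  proof (rule sum.cong)
    fix n
    \<comment> \<open>The sign between \<open>(fls_X - 1) ^ k\<close> and
      \<open>(1 - fls_X) ^ k\<close> is exactly what changes the sign for \<open>m\<close> into the
      one for \<open>m - k\<close>.\<close>
    have "(-1) powi (m - int k) = (-1) powi m * (-1 :: complex) ^ k"
      by (simp add: power_int_diff field_simps flip: power_mult_distrib)
    moreover have "m - int k - (a - (d + int k - n)) = d - a + m - n"
      "- (a - (d + int k - n)) - 1 = d + int k - n - a - 1" "- (m - int k) - 1 = - m - 1 + int k"
      by simp_all
    ultimately show "R n * ((?M powi (m - int k)) $$ (d - a + m - n)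
          - (-1) powi m * (-1) ^ k * (?M powi (m - int k)) $$ (a - (d + int k - n)))
        = R n * (?L powi (d + int k - n - a - 1)) $$ (- m - 1 + int k)"
      using delta_identity[of "m - int k" "a - (d + int k - n)"] by (simp only:)
  qed simp
  also have "\<dots> = (?L powi (- a - 1) * q) $$ (- m - 1)"
    unfolding qm sh by simp
  finally show ?thesis .
qed

text \<open>The residue of a derivative is zero. For (1+z)^(\<epsilon>-1-a) g^(-j-1) with g' =
  (1+z)^(-\<epsilon>) this lowers the order of the pole by one and replaces \<open>a\<close> by a -
  (\<epsilon>-1), so \<open>a\<close> must vary in the induction. The base case holds because g
  begins with z.\<close>

lemma residue_g_eps:
  "((1 + fls_X) powi (- a - 1) * fps_to_fls (g_eps \<epsilon>) powi (- int j - 1)) $$ (-1)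
    = (\<Prod>i<j. of_int (\<epsilon> - 1 - a) + of_nat i * of_int (\<epsilon> - 1)) / fact j"
proof (induction j arbitrary: a)
  case 0
  let ?g = "fps_to_fls (g_eps \<epsilon>)"
  define h where "h = (1 + fls_X) powi (- a - 1) * ?g powi (- 1)"
  note nz = one_plus_X_nonzero
  have "subdegree (g_eps \<epsilon>) = 1" by (rule subdegreeI) auto
  hence sg: "fls_subdegree ?g = 1" by (simp add: fls_subdegree_fls_to_fps)
  have "fls_subdegree (1 + fls_X :: complex fls) = 0" by (rule fls_subdegree_eqI) auto
  hence sh: "fls_subdegree h = - 1" using nz sg by (simp add: h_def)
  have "h * ?g = (1 + fls_X) powi (- a - 1)" by (simp add: h_def power_int_minus)
  hence "(h * ?g) $$ (fls_subdegree h + fls_subdegree ?g) = 1"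
    by (simp add: sg sh one_plus_X_powi_nth)
  hence "h $$ (-1) = 1" unfolding fls_times_base by (simp add: sg sh)
  thus ?case by (simp add: h_def)
next
  case (Suc j)
  let ?g = "fps_to_fls (g_eps \<epsilon>)" and ?L = "1 + fls_X :: complex fls" and ?s = "\<epsilon> - 1 - a"
  note nz = one_plus_X_nonzero
  have g: "fls_deriv ?g = ?L powi (- \<epsilon>)" by (simp add: fls_deriv_fps_to_fls g_eps_deriv)
  have "fls_deriv (?L powi ?s * ?g powi (- int (Suc j)))
      = of_int ?s * (?L powi (?s - 1) * ?g powi (- int (Suc j)))
      + of_int (- int (Suc j)) * (?L powi ?s * ?L powi (- \<epsilon>) * ?g powi (- int (Suc j) - 1))"
    using nz by (simp only: fls_deriv_mult fls_deriv_powi[OF nz(1)] fls_deriv_powi g fps_to_fls_eq_0_iff g_eps_nonzero)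
      (simp only: fls_deriv_powi g fps_to_fls_eq_0_iff g_eps_nonzero not_False_eq_True fls_deriv_add fls_deriv_one fls_deriv_X, simp only: mult_ac add_ac mult_1 add_0 add_0_right)
  also have "?L powi ?s * ?L powi (- \<epsilon>) = ?L powi (- a - 1)"
  proof -
    have "?s + - \<epsilon> = - a - 1" by simp
    thus ?thesis using power_int_add[of ?L ?s "- \<epsilon>"] nz by (simp only: simp_thms)
  qed
  finally have D: "fls_deriv (?L powi ?s * ?g powi (- int (Suc j)))
      = of_int ?s * (?L powi (?s - 1) * ?g powi (- int (Suc j)))
      + of_int (- int (Suc j)) * (?L powi (- a - 1) * ?g powi (- int (Suc j) - 1))" .
  have idx: "?s - 1 = - (a - (\<epsilon> - 1)) - 1" "- int (Suc j) = - int j - 1" by simp_all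
  have "0 = fls_deriv (?L powi ?s * ?g powi (- int (Suc j))) $$ (-1)" by (rule fls_deriv_residue[symmetric])
  also have "\<dots> = of_int ?s * (?L powi (- (a - (\<epsilon> - 1)) - 1) * ?g powi (- int j - 1)) $$ (-1)
      + of_int (- int (Suc j)) * (?L powi (- a - 1) * ?g powi (- int (Suc j) - 1)) $$ (-1)"
    unfolding D fls_plus_nth fls_mult_of_int_nth by (simp only: idx)
  also have "of_int (- int (Suc j)) = - (of_nat (Suc j) :: complex)" by simp
  finally have "(?L powi (- a - 1) * ?g powi (- int (Suc j) - 1)) $$ (-1)
      = of_int ?s * ((\<Prod>i<j. of_int (\<epsilon> - 1 - (a - (\<epsilon> - 1))) + of_nat i * of_int (\<epsilon> - 1)) / fact j) / of_nat (Suc j)"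
    unfolding Suc.IH by (simp add: field_simps del: of_nat_Suc of_int_diff)
  also have "\<dots> = (of_int ?s * (\<Prod>i<j. of_int ?s + of_nat (Suc i) * of_int (\<epsilon> - 1))) / fact (Suc j)"
    by (simp add: algebra_simps)
  also have "of_int ?s * (\<Prod>i<j. of_int ?s + of_nat (Suc i) * of_int (\<epsilon> - 1))
      = (\<Prod>i<Suc j. of_int ?s + of_nat i * of_int (\<epsilon> - 1) :: complex)"
    unfolding prod.lessThan_Suc_shift by simp
  finally show ?case .
qed

section \<open>Coordinated modules on a line of constant total degree\<close>

context phi_coordinated_module
begin

lemma YW_0_left [simp]: "YW 0 w n = 0"
  using YW_linear by (rule linear_zero)

lemma YW_0_right [simp]: "YW v 0 n = 0"
proof -
  have "Vector_Spaces.linear sW sW (\<lambda>w. YW v w n)" using YW_Hom[of v] by (simp add: in_Hom_def)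
  thus ?thesis by (rule linear_zero)
qed

lemma YW_low: obtains N where "\<And>n. n < N \<Longrightarrow> YW v w n = 0"
  using YW_Hom[of v] unfolding in_Hom_def laurent1_def by blast

lemma Y_low: obtains N where "\<And>n. n < N \<Longrightarrow> Y u v n = 0"
  using V.Y_Hom[of u] unfolding in_Hom_def laurent1_def by blast

text \<open>
  The part of total degree \<open>d\<close> of \<open>Y\<^sub>W(u, x\<^sub>1) Y\<^sub>W(v, x\<^sub>2) w\<close>, and the part of
  \<open>Y\<^sub>W(Y(u, x\<^sub>0) v, x\<^sub>2) w\<close> that is homogeneous of degree \<open>d\<close> when \<open>x\<^sub>0\<close> has degree \<open>1 - \<epsilon>\<close>.
\<close>

definition prod_line :: "('w \<Rightarrow> complex) \<Rightarrow> int \<Rightarrow> 'v \<Rightarrow> 'v \<Rightarrow> 'w \<Rightarrow> complex fls"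
  where "prod_line \<mu> d u v w = Abs_fls (\<lambda>b. \<mu> (YW u (YW v w b) (d - b)))"

definition iter_line :: "('w \<Rightarrow> complex) \<Rightarrow> int \<Rightarrow> 'v \<Rightarrow> 'v \<Rightarrow> 'w \<Rightarrow> complex fls"
  where "iter_line \<mu> d u v w = Abs_fls (\<lambda>m. \<mu> (YW (Y u v m) w (d + m * (\<epsilon> - 1))))"

lemma prod_line_nth:
  assumes "functional sW \<mu>"
  shows "prod_line \<mu> d u v w $$ b = \<mu> (YW u (YW v w b) (d - b))"
  unfolding prod_line_def
proof (rule laurent1_nth)
  obtain N where "\<And>n. n < N \<Longrightarrow> YW v w n = 0" using YW_low[of v w] by blast
  thus "laurent1 (\<lambda>b. \<mu> (YW u (YW v w b) (d - b)))"
    by (auto simp: laurent1_def functional_0[OF assms] intro!: exI[of _ N])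
qed

lemma iter_line_nth:
  assumes "functional sW \<mu>"
  shows "iter_line \<mu> d u v w $$ m = \<mu> (YW (Y u v m) w (d + m * (\<epsilon> - 1)))"
  unfolding iter_line_def
proof (rule laurent1_nth)
  obtain N where "\<And>n. n < N \<Longrightarrow> Y u v n = 0" using Y_low[of u v] by blast
  thus "laurent1 (\<lambda>m. \<mu> (YW (Y u v m) w (d + m * (\<epsilon> - 1))))"
    by (auto simp: laurent1_def functional_0[OF assms] intro!: exI[of _ N])
qed

lemma fmul_binom_pow_Yprod:
  assumes \<mu>: "functional sW \<mu>"
  shows "\<mu> (fmul sW (binom_pow (-1) n) (Yprod YW u v w) (a, b))
    = ((1 - fls_X) powi n * prod_line \<mu> (a + b - n) u v w) $$ b"
proof -
  obtain N where "\<And>n. n < N \<Longrightarrow> YW v w n = 0" using YW_low[of v w] by blast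
  hence "\<mu> (fmul sW (binom_pow (-1) n) (Yprod YW u v w) (a, b))
      = ((1 + fls_const (-1) * fls_X) powi n * Abs_fls (\<lambda>j. \<mu> (Yprod YW u v w (a + b - n - j, j)))) $$ b"
    by (intro functional_fmul_binom_pow[OF W.vector_space_axioms _ \<mu>, of _ N]) (simp_all add: Yprod_def)
  thus ?thesis by (simp add: prod_line_def Yprod_def)
qed

lemma fmul_phi_Yiter:
  assumes \<mu>: "functional sW \<mu>"
  shows "\<mu> (fmul sW (ser2 ((phi \<epsilon> - fls_const fls_X) ^ k)) (Yiter Y YW u v w) (c, d + int k + c * (\<epsilon> - 1)))
    = ((Psi \<epsilon> - 1) ^ k * iter_line \<mu> d u v w) $$ c"
proof -
  let ?r = "\<epsilon> - 1" and ?P = "(Psi \<epsilon> - 1) ^ k" and ?b = "d + int k + c * (\<epsilon> - 1)"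
  let ?t = "\<lambda>i. sW (?P $$ i) (YW (Y u v (c - i)) w (d + (c - i) * ?r))"
  have "fmul sW (ser2 ((phi \<epsilon> - fls_const fls_X) ^ k)) (Yiter Y YW u v w) (c, ?b)
      = Sum_any (\<lambda>i. sW (ser2 ((phi \<epsilon> - fls_const fls_X) ^ k) (i, int k + i * ?r))
          (Yiter Y YW u v w ((c, ?b) - (i, int k + i * ?r))))"
    unfolding fmul_def
  proof (rule Sum_any_reindex)
    show "inj (\<lambda>i. (i, int k + i * ?r))" by (rule injI) simp
    fix x :: "int \<times> int" assume "x \<notin> range (\<lambda>i. (i, int k + i * ?r))"
    hence "snd x \<noteq> int k + fst x * ?r" by (cases x) (auto simp: image_iff)
    hence "ser2 ((phi \<epsilon> - fls_const fls_X) ^ k) x = 0"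
      using ser2_phi_diff_power[of \<epsilon> k "fst x" "snd x"] by simp
    thus "sW (ser2 ((phi \<epsilon> - fls_const fls_X) ^ k) x) (Yiter Y YW u v w ((c, ?b) - x)) = 0"
      by simp
  qed
  also have "\<dots> = Sum_any ?t"
  proof (rule Sum_any.cong)
    fix i
    have "(c, ?b) - (i, int k + i * ?r) = (c - i, d + (c - i) * ?r)"
      by (simp add: algebra_simps)
    thus "sW (ser2 ((phi \<epsilon> - fls_const fls_X) ^ k) (i, int k + i * ?r))
          (Yiter Y YW u v w ((c, ?b) - (i, int k + i * ?r))) = ?t i"
      by (simp only: ser2_phi_diff_power Yiter_def prod.case if_True simp_thms)
  qed
  finally have *: "fmul sW (ser2 ((phi \<epsilon> - fls_const fls_X) ^ k)) (Yiter Y YW u v w) (c, ?b) = Sum_any ?t" .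
  obtain N where N: "\<And>n. n < N \<Longrightarrow> Y u v n = 0" using Y_low[of u v] by blast
  have "finite {i. ?t i \<noteq> 0}"
  proof (rule finite_support_int[of "fls_subdegree ?P" _ "c - N"])
    show "?t i = 0" if "i > c - N" for i using that by (simp add: N)
  qed simp
  hence "\<mu> (Sum_any ?t) = Sum_any (\<lambda>i. ?P $$ i * iter_line \<mu> d u v w $$ (c - i))"
    by (simp only: functional_Sum_any[OF \<mu>] functional_scale[OF \<mu>] iter_line_nth[OF \<mu>])
  thus ?thesis by (simp only: * fls_times_Sum_any)
qed

text \<open>Truncation in both variables leaves finitely many exponents on each line, so the cleared
  product is a Laurent polynomial. The product is a series in \<open>x\<^sub>2 / x\<^sub>1\<close>
  while the substitution sets \<open>x\<^sub>1 / x\<^sub>2\<close> to \<psi>, hence the exponents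
  \<open>n\<close> and \<open>d + k - n\<close>.\<close>

lemma associativity_line:
  assumes \<mu>: "functional sW \<mu>"
  obtains k S and R :: "int \<Rightarrow> complex" where "(1 - fls_X) ^ k * prod_line \<mu> d u v w = (\<Sum>n\<in>S. fls_const (R n) * fls_X powi n)"
    and "(Psi \<epsilon> - 1) ^ k * iter_line \<mu> d u v w
      = (\<Sum>n\<in>S. fls_const (R n) * Psi \<epsilon> powi (d + int k - n))"
proof -
  obtain k where H: "in_Hom sW laurent2 (\<lambda>w. fmul sW (binom_pow (-1) (int k)) (Yprod YW u v w))"
    and eq: "\<And>w. fmul sW (ser2 ((phi \<epsilon> - fls_const fls_X) ^ k)) (Yiter Y YW u v w)
        = fsubst sW (\<lambda>m. ser2 (phi \<epsilon> powi m)) (fmul sW (binom_pow (-1) (int k)) (Yprod YW u v w))"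
    using phi_associativity[of u v] by blast
  define A where "A = fmul sW (binom_pow (-1) (int k)) (Yprod YW u v w)"
  obtain N where N: "\<And>m n. m < N \<or> n < N \<Longrightarrow> A (m, n) = 0"
    using H unfolding in_Hom_def laurent2_def A_def by blast
  let ?D = "d + int k"
  define S where "S = {N..?D - N}"
  define R where "R = (\<lambda>n. \<mu> (A (?D - n, n)))"
  have R0: "A (?D - n, n) = 0" if "n \<notin> S" for n
    using that by (intro N) (auto simp: S_def)
  have line: "((1 - fls_X) ^ k * prod_line \<mu> d u v w) $$ n = R n" for n
    using fmul_binom_pow_Yprod[OF \<mu>, of "int k" u v w "?D - n" n] by (simp add: R_def A_def)
  have 1: "(1 - fls_X) ^ k * prod_line \<mu> d u v w = (\<Sum>n\<in>S. fls_const (R n) * fls_X powi n)"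
  proof (rule fls_eqI)
    fix b
    have "(\<Sum>n\<in>S. fls_const (R n) * fls_X powi n) $$ b = (\<Sum>n\<in>S. if n = b then R n else 0)"
      unfolding fls_nth_sum by (intro sum.cong) auto
    also have "\<dots> = R b"
      using R0[of b] by (auto simp: S_def R_def functional_0[OF \<mu>])
    finally show "((1 - fls_X) ^ k * prod_line \<mu> d u v w) $$ b = (\<Sum>n\<in>S. fls_const (R n) * fls_X powi n) $$ b"
      by (simp only: line)
  qed
  have 2: "(Psi \<epsilon> - 1) ^ k * iter_line \<mu> d u v w = (\<Sum>n\<in>S. fls_const (R n) * Psi \<epsilon> powi (?D - n))"
  proof (rule fls_eqI)
    fix c
    let ?b = "?D + c * (\<epsilon> - 1)"
    have "fsubst sW (\<lambda>m. ser2 (phi \<epsilon> powi m)) A (c, ?b)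
        = Sum_any (\<lambda>n. sW (ser2 (phi \<epsilon> powi (?D - n)) (c, ?b - n)) (A (?D - n, n)))"
      by (rule fsubst_line) (simp add: ser2_phi_powi)
    also have "\<dots> = Sum_any (\<lambda>n. sW ((Psi \<epsilon> powi (?D - n)) $$ c) (A (?D - n, n)))"
      by (intro Sum_any.cong) (simp add: ser2_phi_powi)
    also have "\<dots> = (\<Sum>n\<in>S. sW ((Psi \<epsilon> powi (?D - n)) $$ c) (A (?D - n, n)))"
    proof (rule Sum_any.expand_superset)
      show "finite S" by (simp add: S_def)
      show "{n. sW ((Psi \<epsilon> powi (?D - n)) $$ c) (A (?D - n, n)) \<noteq> 0} \<subseteq> S"
        using R0 by force
    qed
    finally have "\<mu> (fsubst sW (\<lambda>m. ser2 (phi \<epsilon> powi m)) A (c, ?b))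
        = (\<Sum>n\<in>S. R n * (Psi \<epsilon> powi (?D - n)) $$ c)"
      by (simp only: functional_sum[OF \<mu>] functional_scale[OF \<mu>] R_def mult.commute)
    moreover have "\<mu> (fsubst sW (\<lambda>m. ser2 (phi \<epsilon> powi m)) A (c, ?b))
        = ((Psi \<epsilon> - 1) ^ k * iter_line \<mu> d u v w) $$ c"
      unfolding A_def eq[symmetric] by (rule fmul_phi_Yiter[OF \<mu>])
    ultimately show "((Psi \<epsilon> - 1) ^ k * iter_line \<mu> d u v w) $$ c
        = (\<Sum>n\<in>S. fls_const (R n) * Psi \<epsilon> powi (?D - n)) $$ c"
      by (simp add: fls_nth_sum)
  qed
  show ?thesis by (rule that[OF 1 2])
qed

text \<open>Taking \<open>v = \<one>\<close> in associativity yields \<open>Y\<^sub>W(Y(v, x\<^sub>0) \<one>, x\<^sub>2) = Y\<^sub>W(v, \<phi>\<^sub>\<epsilon>(x\<^sub>2, x\<^sub>0))\<close>.\<close>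

lemma iter_line_vac:
  assumes \<mu>: "functional sW \<mu>"
  shows "iter_line \<mu> d v vac w = fls_const (\<mu> (YW v w d)) * Psi \<epsilon> powi d"
proof -
  let ?\<alpha> = "fls_const (\<mu> (YW v w d))" and ?P = "Psi \<epsilon>"
  obtain k S R where 1: "(1 - fls_X) ^ k * prod_line \<mu> d v vac w = (\<Sum>n\<in>S. fls_const (R n) * fls_X powi n)"
    and 2: "(?P - 1) ^ k * iter_line \<mu> d v vac w = (\<Sum>n\<in>S. fls_const (R n) * ?P powi (d + int k - n))"
    by (rule associativity_line[OF \<mu>, where d = d and u = v and v = vac and w = w])
  define F where "F = (\<lambda>\<xi>. (1 - \<xi>) ^ k * ?\<alpha> - (\<Sum>n\<in>S. fls_const (R n) * \<xi> powi n))"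
  have "prod_line \<mu> d v vac w = ?\<alpha>"
    by (rule fls_eqI) (simp add: prod_line_nth[OF \<mu>] YW_vacuum fmonom_def functional_0[OF \<mu>])
  hence "F fls_X = 0" using 1 by (simp add: F_def)
  moreover have "laurent_poly F" unfolding F_def by (intro laurent_poly_intros)
  \<comment> \<open>The variable of \<open>F\<close> is \<open>x\<^sub>2 / x\<^sub>1\<close>, which
    becomes 1 / \<psi> at \<open>x\<^sub>1\<close> = \<phi>.\<close>
  ultimately have "F (inverse ?P) = 0" by (intro laurent_poly_identity) auto
  hence F: "(1 - inverse ?P) ^ k * ?\<alpha> = (\<Sum>n\<in>S. fls_const (R n) * inverse ?P powi n)"
    by (simp add: F_def)
  have "(?P - 1) ^ k * iter_line \<mu> d v vac w = ?P powi (d + int k) * (\<Sum>n\<in>S. fls_const (R n) * inverse ?P powi n)"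
    unfolding 2 by (simp add: sum_distrib_left power_int_diff power_int_inverse field_simps)
  also have "\<dots> = ?P powi d * (?P * (1 - inverse ?P)) ^ k * ?\<alpha>"
    unfolding F[symmetric] by (simp add: power_int_add power_mult_distrib mult_ac)
  also have "?P * (1 - inverse ?P) = ?P - 1" by (simp add: right_diff_distrib)
  finally have "(?P - 1) ^ k * iter_line \<mu> d v vac w = (?P - 1) ^ k * (?\<alpha> * ?P powi d)"
    by (simp add: mult_ac)
  moreover have "(?P - 1) ^ k \<noteq> 0"
    using psi_minus_1(2)[of \<epsilon>] by (metis fps_one_to_fls fps_to_fls_eq_0_iff fps_to_fls_minus power_not_zero)
  ultimately show ?thesis by simp
qed

text \<open>Skew symmetry rewrites the iterate through e^(zD) Y(v, -z) u, and
  \<open>iter_line_vac\<close> moves e^(zD) into the argument, replacing \<open>x\<^sub>2\<close> by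
  \<open>x\<^sub>2\<close> \<psi>. On a line of degree \<open>d\<close> this produces the factor
  \<psi>^d and turns -z into \<theta>.\<close>

lemma iter_line_skew:
  assumes \<mu>: "functional sW \<mu>"
  shows "iter_line \<mu> d u v w = Psi \<epsilon> powi d * fls_compose_fps (iter_line \<mu> d v u w) (theta \<epsilon>)"
proof (rule fls_eqI)
  fix m
  let ?r = "\<epsilon> - 1" and ?P = "Psi \<epsilon>" and ?q = "iter_line \<mu> d v u w"
  have "functional sV (\<lambda>x. \<mu> (YW x w (d + m * ?r)))"
    by (rule functional_compose[OF YW_linear \<mu>])
  hence "iter_line \<mu> d u v w $$ m
      = Sum_any (\<lambda>i. (-1) powi (m - i) * \<mu> (YW (Y (Y v u (m - i)) vac i) w (d + m * ?r)))"
    unfolding iter_line_nth[OF \<mu>] by (rule V.skew_symmetry)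
  also have "\<dots> = Sum_any (\<lambda>j. (-1) powi (m - (m - j)) * \<mu> (YW (Y (Y v u (m - (m - j))) vac (m - j)) w (d + m * ?r)))"
    by (rule Sum_any_reindex) (auto simp: inj_def intro: range_eqI[of _ _ "m - x" for x])
  also have "\<dots> = Sum_any (\<lambda>j. ?q $$ j * (?P powi d * fps_to_fls (theta \<epsilon>) powi j) $$ m)"
  proof (rule Sum_any.cong)
    fix j
    have "\<mu> (YW (Y (Y v u j) vac (m - j)) w ((d + j * ?r) + (m - j) * ?r))
        = \<mu> (YW (Y v u j) w (d + j * ?r)) * (?P powi (d + j * ?r)) $$ (m - j)"
      using arg_cong[OF iter_line_vac[OF \<mu>, of "d + j * ?r" "Y v u j" w], of "\<lambda>f. f $$ (m - j)"]
      by (simp only: iter_line_nth[OF \<mu>] fls_mult_const_nth)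
    moreover have "(d + j * ?r) + (m - j) * ?r = d + m * ?r" by (simp add: algebra_simps)
    moreover have "?P powi d * fps_to_fls (theta \<epsilon>) powi j
        = fls_const ((-1) powi j) * (fls_X_intpow j * ?P powi (d + j * ?r))"
    proof -
      have "fps_to_fls (theta \<epsilon>) = fls_const (-1) * fls_X * ?P powi ?r" by (simp add: fls_theta)
      hence "fps_to_fls (theta \<epsilon>) powi j = fls_const (-1) powi j * fls_X powi j * ?P powi (?r * j)"
        by (simp only: power_int_mult_distrib power_int_mult)
      thus ?thesis
        by (simp add: power_int_add fls_const_power_int mult_ac del: of_int_diff)
    qed
    hence "(?P powi d * fps_to_fls (theta \<epsilon>) powi j) $$ m = (-1) powi j * (?P powi (d + j * ?r)) $$ (m - j)"
      by (simp add: fls_X_intpow_times_conv_shift)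
    ultimately show "(-1) powi (m - (m - j)) * \<mu> (YW (Y (Y v u (m - (m - j))) vac (m - j)) w (d + m * ?r))
        = ?q $$ j * (?P powi d * fps_to_fls (theta \<epsilon>) powi j) $$ m"
      by (simp add: iter_line_nth[OF \<mu>])
  qed
  also have "\<dots> = (?P powi d * fls_compose_fps ?q (theta \<epsilon>)) $$ m"
    by (rule fls_compose_fps_nth[symmetric]) simp_all
  finally show "iter_line \<mu> d u v w $$ m = (?P powi d * fls_compose_fps ?q (theta \<epsilon>)) $$ m" .
qed

text \<open>
  Both \<open>(x\<^sub>1 - x\<^sub>2)\<^sup>k Y\<^sub>W(u, x\<^sub>1) Y\<^sub>W(v, x\<^sub>2) w\<close> and \<open>(x\<^sub>1 - x\<^sub>2)\<^sup>k Y\<^sub>W(v, x\<^sub>2) Y\<^sub>W(u, x\<^sub>1) w\<close> are Laurent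
  polynomials on each line, and skew symmetry makes them agree at \<open>x\<^sub>1 = \<phi>\<^sub>\<epsilon>(x\<^sub>2, x\<^sub>0)\<close>.
\<close>

lemma rational_line:
  assumes \<mu>: "functional sW \<mu>"
  obtains k S R where
    "(1 - fls_X) ^ k * prod_line \<mu> d u v w = (\<Sum>n\<in>S. fls_const (R n) * fls_X powi n)"
    "(fls_X - 1) ^ k * prod_line \<mu> d v u w = (\<Sum>n\<in>S. fls_const (R n) * fls_X powi (d + int k - n))"
    "fls_X ^ k * fls_compose_fps (iter_line \<mu> d u v w) (g_eps \<epsilon>)
      = (\<Sum>n\<in>S. fls_const (R n) * (1 + fls_X) powi (d + int k - n))"
proof -
  let ?P = "Psi \<epsilon>" and ?p = "iter_line \<mu> d u v w" and ?p' = "iter_line \<mu> d v u w"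
  obtain k S R where 1: "(1 - fls_X) ^ k * prod_line \<mu> d u v w = (\<Sum>n\<in>S. fls_const (R n) * fls_X powi n)"
    and 2: "(?P - 1) ^ k * ?p = (\<Sum>n\<in>S. fls_const (R n) * ?P powi (d + int k - n))"
    by (rule associativity_line[OF \<mu>, where d = d and u = u and v = v and w = w])
  obtain k' S' R' where b1: "(1 - fls_X) ^ k' * prod_line \<mu> d v u w = (\<Sum>n\<in>S'. fls_const (R' n) * fls_X powi n)"
    and b2: "(?P - 1) ^ k' * ?p' = (\<Sum>n\<in>S'. fls_const (R' n) * ?P powi (d + int k' - n))"
    by (rule associativity_line[OF \<mu>, where d = d and u = v and v = u and w = w])
  define L where "L = (\<lambda>\<xi>. \<Sum>n\<in>S. fls_const (R n) * \<xi> powi (d + int k - n))"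
  define L' where "L' = (\<lambda>\<xi>. \<Sum>n\<in>S'. fls_const (R' n) * \<xi> powi n)"
  \<comment> \<open>Substituting \<theta> inverts \<psi>, so that associativity for the opposite
    order is expressed in the variable used for the given order.\<close>
  have "(inverse ?P - 1) ^ k' * fls_compose_fps ?p' (theta \<epsilon>)
      = fls_compose_fps ((?P - 1) ^ k' * ?p') (theta \<epsilon>)"
    by (simp add: fls_compose_fps_mult fls_compose_fps_power fls_compose_fps_diff Psi_compose_theta
         del: fls_compose_fps_to_fls)
  also have "\<dots> = (\<Sum>n\<in>S'. fls_const (R' n) * inverse ?P powi (d + int k' - n))"
    unfolding b2 by (simp add: fls_compose_fps_sum fls_compose_fps_mult fls_compose_fps_powi Psi_compose_theta
         del: fls_compose_fps_to_fls)
  also have "\<dots> = inverse ?P powi (d + int k') * L' ?P"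
    by (simp add: L'_def sum_distrib_left power_int_diff power_int_inverse field_simps)
  finally have "?P powi (d + int k') * ((inverse ?P - 1) ^ k' * fls_compose_fps ?p' (theta \<epsilon>)) = L' ?P"
    by (simp add: power_int_inverse)
  also have "?P powi (d + int k') * ((inverse ?P - 1) ^ k' * fls_compose_fps ?p' (theta \<epsilon>))
      = (?P * (inverse ?P - 1)) ^ k' * (?P powi d * fls_compose_fps ?p' (theta \<epsilon>))"
    by (simp add: power_int_add power_mult_distrib mult_ac)
  also have "?P * (inverse ?P - 1) = 1 - ?P" by (simp add: right_diff_distrib)
  also have "?P powi d * fls_compose_fps ?p' (theta \<epsilon>) = ?p"
    by (rule iter_line_skew[OF \<mu>, symmetric])
  finally have "(1 - ?P) ^ k' * ?p = L' ?P" .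
  \<comment> \<open>The two orders come with unrelated exponents \<open>k\<close> and
    \<open>k'\<close>; cross-multiplication eliminates the common iterate \<open>?p\<close>.\<close>
  hence "(1 - ?P) ^ k' * ((?P - 1) ^ k * ?p) = (?P - 1) ^ k * L' ?P"
    by (metis mult.left_commute)
  moreover define F where "F = (\<lambda>\<xi>. (1 - \<xi>) ^ k' * L \<xi> - (\<xi> - 1) ^ k * L' \<xi>)"
  ultimately have "F ?P = 0" unfolding 2 by (simp add: F_def L_def)
  moreover have "laurent_poly F" unfolding F_def L_def L'_def by (intro laurent_poly_intros)
  \<comment> \<open>Now \<open>fls_X\<close> stands for \<open>x\<^sub>1 / x\<^sub>2\<close>, the
    variable of the opposite product, and the surplus \<open>k'\<close>-th power cancels.\<close>
  ultimately have "F fls_X = 0" by (intro laurent_poly_identity[of F \<epsilon>]) auto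
  hence "(1 - fls_X) ^ k' * ((fls_X - 1) ^ k * prod_line \<mu> d v u w) = (1 - fls_X) ^ k' * L fls_X"
    using b1 unfolding F_def L'_def by (simp add: mult.left_commute)
  hence f': "(fls_X - 1) ^ k * prod_line \<mu> d v u w = (\<Sum>n\<in>S. fls_const (R n) * fls_X powi (d + int k - n))"
    using one_plus_X_nonzero unfolding L_def by simp
  have "fls_X ^ k * fls_compose_fps ?p (g_eps \<epsilon>) = fls_compose_fps ((?P - 1) ^ k * ?p) (g_eps \<epsilon>)"
    by (simp add: fls_compose_fps_mult fls_compose_fps_power fls_compose_fps_diff Psi_compose_g_eps
         del: fls_compose_fps_to_fls)
  also have "\<dots> = (\<Sum>n\<in>S. fls_const (R n) * (1 + fls_X) powi (d + int k - n))"
    unfolding 2 by (simp add: fls_compose_fps_sum fls_compose_fps_mult fls_compose_fps_powi Psi_compose_g_eps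
         del: fls_compose_fps_to_fls)
  finally show ?thesis by (rule that[OF 1 f'])
qed

text \<open>The exponent of z is \<open>- m - 1\<close>; thus \<open>m = 0\<close> is the residue in
  z, which yields the commutator.\<close>

lemma jacobi_coefficient:
  assumes \<mu>: "functional sW \<mu>"
  shows "((1 - fls_X) powi m * prod_line \<mu> d u v w) $$ (d - a + m)
      - (-1) powi m * ((1 - fls_X) powi m * prod_line \<mu> d v u w) $$ a
    = ((1 + fls_X) powi (- a - 1) * fls_compose_fps (iter_line \<mu> d u v w) (g_eps \<epsilon>)) $$ (- m - 1)"
proof -
  obtain k S R where
    "(1 - fls_X) ^ k * prod_line \<mu> d u v w = (\<Sum>n\<in>S. fls_const (R n) * fls_X powi n)"
    "(fls_X - 1) ^ k * prod_line \<mu> d v u w = (\<Sum>n\<in>S. fls_const (R n) * fls_X powi (d + int k - n))"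
    "fls_X ^ k * fls_compose_fps (iter_line \<mu> d u v w) (g_eps \<epsilon>)
      = (\<Sum>n\<in>S. fls_const (R n) * (1 + fls_X) powi (d + int k - n))"
    by (rule rational_line[OF \<mu>, where d = d and u = u and v = v and w = w])
  thus ?thesis by (rule jacobi_line)
qed

end

section \<open>Coefficients of the delta functions\<close>

lemma fmul_fmonom_left:
  "fmul (*) (fmonom k (c :: complex)) f i = c * f (i - k)"
proof -
  have "fmul (*) (fmonom k c) f i = fmonom k c k * f (i - k)"
    unfolding fmul_def by (rule Sum_any_single) (simp add: fmonom_def)
  thus ?thesis by (simp add: fmonom_def)
qed

lemma fmul_fmonom_right:
  "fmul (*) f (fmonom k (c :: complex)) i = f (i - k) * c"
proof -
  have "fmul (*) f (fmonom k c) i = f (i - k) * fmonom k c (i - (i - k))"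
    unfolding fmul_def by (rule Sum_any_single) (auto simp: fmonom_def)
  thus ?thesis by (simp add: fmonom_def)
qed

text \<open>The prefactor shifts the exponent of z by one, so \<open>z^c\<close> selects the summand
  \<open>n = - c - 1\<close>.\<close>

lemma delta_12_nth: "delta_12 (a, b, c) = binom_pow (-1) (- c - 1) (a, b - c)"
proof -
  have "fdelta (\<lambda>n. fmul (*) (emb12 (binom_pow (-1) n)) (fmonom (0, -n, -n) 1)) (a, b + 1, c + 1)
      = fmul (*) (emb12 (binom_pow (-1) (- c - 1))) (fmonom (0, - (- c - 1), - (- c - 1)) 1) (a, b + 1, c + 1)"
    unfolding fdelta_def
    by (rule Sum_any_single) (auto simp: fmul_fmonom_right emb12_def)
  thus ?thesis
    by (simp add: delta_12_def fmul_fmonom_left fmul_fmonom_right emb12_def)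
qed

lemma delta_21_nth:
  "delta_21 (a, b, c) = (-1) powi (- c - 1) * binom_pow (-1) (- c - 1) (b - c, a)"
proof -
  have "fdelta (\<lambda>n. fmul (*) (emb12 (binom_pow (-1) n \<circ> prod.swap)) (fmonom (0, -n, -n) ((-1) powi (-n)))) (a, b + 1, c + 1)
      = fmul (*) (emb12 (binom_pow (-1) (- c - 1) \<circ> prod.swap))
          (fmonom (0, - (- c - 1), - (- c - 1)) ((-1) powi (- (- c - 1)))) (a, b + 1, c + 1)"
    unfolding fdelta_def
    by (rule Sum_any_single) (auto simp: fmul_fmonom_right emb12_def)
  moreover have "(-1) powi (- (- c - 1)) = ((-1) powi (- c - 1) :: complex)"
    by (rule power_int_minus_one_minus)
  ultimately show ?thesis
    by (simp add: delta_21_def fmul_fmonom_left fmul_fmonom_right emb12_def)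
qed

lemma delta_iter_nth:
  "delta_iter (a, b, c) = (if b = - a - 1 then ((1 + fls_X) powi (- a - 1)) $$ c else 0)"
proof -
  have "fdelta (\<lambda>n. fmul (*) (fmonom (-n, n, 0) 1) (embz2 (ser2 ((1 + fls_X) powi n)))) (a + 1, b, c)
      = fmul (*) (fmonom (- (- a - 1), - a - 1, 0) 1) (embz2 (ser2 ((1 + fls_X) powi (- a - 1)))) (a + 1, b, c)"
    unfolding fdelta_def
    by (rule Sum_any_single) (auto simp: fmul_fmonom_left embz2_def)
  thus ?thesis
    by (simp add: delta_iter_def fmul_fmonom_left embz2_def ser2_one_plus_X_powi)
qed

lemma fmul_delta_12:
  assumes "vector_space s"
  shows "fmul s delta_12 (emb12 F) (a, b, c) = fmul s (binom_pow (-1) (- c - 1)) F (a, b - c)"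
proof -
  interpret vector_space s by fact
  let ?h = "\<lambda>(i, j). (i, j + c, c)"
  have "fmul s delta_12 (emb12 F) (a, b, c) = Sum_any (\<lambda>x. s (delta_12 (?h x)) (emb12 F ((a, b, c) - ?h x)))"
    unfolding fmul_def
  proof (rule Sum_any_reindex)
    show "inj ?h" by (auto simp: inj_def)
    fix x :: "int \<times> int \<times> int" assume "x \<notin> range ?h"
    hence "snd (snd x) \<noteq> c"
      by (cases x) (force simp: image_iff split: prod.splits dest: spec[of _ "fst (snd x) - c"])
    thus "s (delta_12 x) (emb12 F ((a, b, c) - x)) = 0" by (cases x) (simp add: emb12_def)
  qed
  also have "\<dots> = fmul s (binom_pow (-1) (- c - 1)) F (a, b - c)"
    unfolding fmul_def
    by (rule Sum_any.cong) (auto simp: delta_12_nth emb12_def algebra_simps split: prod.splits)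
  finally show ?thesis .
qed

lemma fmul_delta_21:
  assumes "vector_space s"
  shows "fmul s delta_21 (emb12 (F \<circ> prod.swap)) (a, b, c)
    = s ((-1) powi (- c - 1)) (fmul s (binom_pow (-1) (- c - 1)) F (b - c, a))"
proof -
  interpret vector_space s by fact
  let ?h = "\<lambda>(i, j). (j, i + c, c)" and ?e = "(-1) powi (- c - 1) :: complex"
  have "fmul s delta_21 (emb12 (F \<circ> prod.swap)) (a, b, c)
      = Sum_any (\<lambda>x. s (delta_21 (?h x)) (emb12 (F \<circ> prod.swap) ((a, b, c) - ?h x)))"
    unfolding fmul_def
  proof (rule Sum_any_reindex)
    show "inj ?h" by (auto simp: inj_def)
    fix x :: "int \<times> int \<times> int" assume "x \<notin> range ?h"
    hence "snd (snd x) \<noteq> c"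
      by (cases x) (force simp: image_iff split: prod.splits dest: spec[of _ "fst (snd x) - c"])
    thus "s (delta_21 x) (emb12 (F \<circ> prod.swap) ((a, b, c) - x)) = 0" by (cases x) (simp add: emb12_def)
  qed
  also have "\<dots> = Sum_any (\<lambda>x. s ?e (s (binom_pow (-1) (- c - 1) x) (F ((b - c, a) - x))))"
    by (rule Sum_any.cong) (auto simp: delta_21_nth emb12_def algebra_simps split: prod.splits)
  also have "\<dots> = s ?e (fmul s (binom_pow (-1) (- c - 1)) F (b - c, a))"
  proof -
    have "?e \<noteq> 0" by simp
    hence "{i. s ?e (f i) \<noteq> 0} = {i. f i \<noteq> 0}" for f :: "int \<times> int \<Rightarrow> 'a" by simp
    thus ?thesis by (simp add: fmul_def Sum_any.expand_set scale_sum_right)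
  qed
  finally show ?thesis .
qed

lemma fmul_delta_iter:
  assumes "vector_space s"
  shows "fmul s delta_iter (embz2 H) (a, b, c)
    = Sum_any (\<lambda>i. s (((1 + fls_X) powi (- a - 1)) $$ i) (H (c - i, a + b + 1)))"
proof -
  interpret vector_space s by fact
  let ?h = "\<lambda>i. (a, - a - 1, i)"
  have "fmul s delta_iter (embz2 H) (a, b, c) = Sum_any (\<lambda>i. s (delta_iter (?h i)) (embz2 H ((a, b, c) - ?h i)))"
    unfolding fmul_def
  proof (rule Sum_any_reindex)
    show "inj ?h" by (auto simp: inj_def)
    fix x :: "int \<times> int \<times> int" assume "x \<notin> range ?h"
    hence "fst x \<noteq> a \<or> fst (snd x) \<noteq> - a - 1" by (cases x) (auto simp: image_iff)
    thus "s (delta_iter x) (embz2 H ((a, b, c) - x)) = 0"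
      by (cases x) (auto simp: embz2_def delta_iter_nth)
  qed
  also have "\<dots> = Sum_any (\<lambda>i. s (((1 + fls_X) powi (- a - 1)) $$ i) (H (c - i, a + b + 1)))"
    by (rule Sum_any.cong) (simp add: delta_iter_nth embz2_def algebra_simps)
  finally show ?thesis .
qed

lemma delta_comm_nth: "delta_comm \<epsilon> (a, b) = (if a + b = \<epsilon> - 1 then 1 else 0)"
proof -
  have "fdelta (\<lambda>n. fmonom (-n, n) 1) (a', b) = fmonom (-b, b) (1 :: complex) (a', b)" for a'
    unfolding fdelta_def by (rule Sum_any_single) (simp add: fmonom_def)
  moreover have "delta_comm \<epsilon> (a, b) = fdelta (\<lambda>n. fmonom (-n, n) 1) (a - (\<epsilon> - 1), b)"
    by (simp add: delta_comm_def fmul_fmonom_left)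
  ultimately have "delta_comm \<epsilon> (a, b) = fmonom (-b, b) 1 (a - (\<epsilon> - 1), b)" by (simp only:)
  thus ?thesis by (auto simp: fmonom_def)
qed

text \<open>At fixed \<open>a\<close> the series starts from
  \<open>x\<^sub>2^(\<epsilon>-1-a)\<close>; each derivation multiplies by the current exponent and
  raises it by \<epsilon>-1, which builds the product of \<open>residue_g_eps\<close>.\<close>

lemma delta_comm_deriv_nth:
  "(x2pow_deriv \<epsilon> ^^ j) (delta_comm \<epsilon>) (a, b)
    = (if a + b = (int j + 1) * (\<epsilon> - 1)
       then \<Prod>i<j. of_int (\<epsilon> - 1 - a) + of_nat i * of_int (\<epsilon> - 1) else 0)"
proof (induction j arbitrary: b)
  case (Suc j)
  have "(x2pow_deriv \<epsilon> ^^ Suc j) (delta_comm \<epsilon>) (a, b)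
      = of_int (b - \<epsilon> + 1) * (x2pow_deriv \<epsilon> ^^ j) (delta_comm \<epsilon>) (a, b - \<epsilon> + 1)"
    by (simp add: x2pow_deriv_def)
  also have "\<dots> = (if a + b = (int (Suc j) + 1) * (\<epsilon> - 1)
       then (\<Prod>i<j. of_int (\<epsilon> - 1 - a) + of_nat i * of_int (\<epsilon> - 1)) * of_int (b - \<epsilon> + 1) else 0)"
  proof -
    have "a + (b - \<epsilon> + 1) = (int j + 1) * (\<epsilon> - 1) \<longleftrightarrow> a + b = (int (Suc j) + 1) * (\<epsilon> - 1)"
      by (auto simp: algebra_simps)
    thus ?thesis unfolding Suc.IH by simp
  qed
  also have "\<dots> = (if a + b = (int (Suc j) + 1) * (\<epsilon> - 1)
       then \<Prod>i<Suc j. of_int (\<epsilon> - 1 - a) + of_nat i * of_int (\<epsilon> - 1) else 0)"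
  proof (cases "a + b = (int (Suc j) + 1) * (\<epsilon> - 1)")
    case True
    hence "b - \<epsilon> + 1 = (\<epsilon> - 1 - a) + int j * (\<epsilon> - 1)" by (simp add: algebra_simps)
    hence "of_int (b - \<epsilon> + 1) = (of_int (\<epsilon> - 1 - a) + of_nat j * of_int (\<epsilon> - 1) :: complex)"
      by (simp only: of_int_add of_int_mult of_int_of_nat_eq)
    thus ?thesis by (simp only: prod.lessThan_Suc)
  qed simp
  finally show ?case .
qed (simp add: delta_comm_nth)

lemma fmul_delta_comm_deriv:
  assumes "vector_space s"
  shows "fmul s ((x2pow_deriv \<epsilon> ^^ j) (delta_comm \<epsilon>)) (emb2 y) (a, b)
    = s (\<Prod>i<j. of_int (\<epsilon> - 1 - a) + of_nat i * of_int (\<epsilon> - 1)) (y (a + b - (int j + 1) * (\<epsilon> - 1)))"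
proof -
  interpret vector_space s by fact
  let ?x = "(a, (int j + 1) * (\<epsilon> - 1) - a)"
  have "fmul s ((x2pow_deriv \<epsilon> ^^ j) (delta_comm \<epsilon>)) (emb2 y) (a, b)
      = s ((x2pow_deriv \<epsilon> ^^ j) (delta_comm \<epsilon>) ?x) (emb2 y ((a, b) - ?x))"
    unfolding fmul_def
  proof (rule Sum_any_single)
    fix x :: "int \<times> int" assume "x \<noteq> ?x"
    thus "s ((x2pow_deriv \<epsilon> ^^ j) (delta_comm \<epsilon>) x) (emb2 y ((a, b) - x)) = 0"
      by (cases x) (auto simp: delta_comm_deriv_nth emb2_def algebra_simps)
  qed
  also have "\<dots> = s (\<Prod>i<j. of_int (\<epsilon> - 1 - a) + of_nat i * of_int (\<epsilon> - 1)) (y (a + b - (int j + 1) * (\<epsilon> - 1)))"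
    unfolding delta_comm_deriv_nth by (simp add: emb2_def algebra_simps)
  finally show ?thesis .
qed

section \<open>The Jacobi identity and the commutator formula\<close>

context phi_coordinated_module
begin

lemma fsubst_f_eps:
  "fsubst sW (\<lambda>m. ser2 (f_eps \<epsilon> powi m)) (Yiter Y YW u v w) (c, d)
    = Sum_any (\<lambda>m. sW ((fps_to_fls (g_eps \<epsilon>) powi m) $$ c) (YW (Y u v m) w (d + m * (\<epsilon> - 1))))"
proof -
  let ?h = "\<lambda>m. (m, d - m * (1 - \<epsilon>))"
  have "fsubst sW (\<lambda>m. ser2 (f_eps \<epsilon> powi m)) (Yiter Y YW u v w) (c, d)
      = Sum_any (\<lambda>x. sW (ser2 (f_eps \<epsilon> powi fst x) (c, d - snd x)) (Yiter Y YW u v w x))"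
    by (simp add: fsubst_def split_def)
  also have "\<dots> = Sum_any (\<lambda>m. sW (ser2 (f_eps \<epsilon> powi fst (?h m)) (c, d - snd (?h m))) (Yiter Y YW u v w (?h m)))"
  proof (rule Sum_any_reindex)
    show "inj ?h" by (auto simp: inj_def)
    fix x :: "int \<times> int" assume "x \<notin> range ?h"
    hence "snd x \<noteq> d - fst x * (1 - \<epsilon>)" by (cases x) (auto simp: image_iff)
    hence "d - snd x \<noteq> fst x * (1 - \<epsilon>)" by linarith
    thus "sW (ser2 (f_eps \<epsilon> powi fst x) (c, d - snd x)) (Yiter Y YW u v w x) = 0"
      by (simp add: ser2_f_eps_powi)
  qed
  also have "\<dots> = Sum_any (\<lambda>m. sW ((fps_to_fls (g_eps \<epsilon>) powi m) $$ c) (YW (Y u v m) w (d + m * (\<epsilon> - 1))))"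
    by (rule Sum_any.cong) (simp add: ser2_f_eps_powi Yiter_def algebra_simps)
  finally show ?thesis .
qed

text \<open>Because g has order 1, its \<open>m\<close>-th power starts at z^m; with the truncation
  of Y(u, x) v this keeps every substitution of f finite.\<close>

lemma g_eps_powi_low: "c < m \<Longrightarrow> (fps_to_fls (g_eps \<epsilon>) powi m) $$ c = 0"
proof -
  assume "c < m"
  have "subdegree (g_eps \<epsilon>) = 1" by (rule subdegreeI) auto
  hence "fls_subdegree (fps_to_fls (g_eps \<epsilon>) powi m) = m"
    by (simp add: fls_subdegree_fls_to_fps)
  hence "c < fls_subdegree (fps_to_fls (g_eps \<epsilon>) powi m)" using \<open>c < m\<close> by (simp only:)
  thus ?thesis by (rule fls_eq0_below_subdegree)
qed

lemma functional_fsubst_f_eps: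
  assumes \<mu>: "functional sW \<mu>"
  shows "\<mu> (fsubst sW (\<lambda>m. ser2 (f_eps \<epsilon> powi m)) (Yiter Y YW u v w) (c, d))
    = fls_compose_fps (iter_line \<mu> d u v w) (g_eps \<epsilon>) $$ c"
proof -
  let ?t = "\<lambda>m. sW ((fps_to_fls (g_eps \<epsilon>) powi m) $$ c) (YW (Y u v m) w (d + m * (\<epsilon> - 1)))"
  obtain N where "\<And>n. n < N \<Longrightarrow> Y u v n = 0" using Y_low[of u v] by blast
  hence fin: "finite {m. ?t m \<noteq> 0}"
    by (intro finite_support_int[of N _ c]) (simp_all add: g_eps_powi_low)
  have "fls_compose_fps (iter_line \<mu> d u v w) (g_eps \<epsilon>) $$ c
      = Sum_any (\<lambda>m. iter_line \<mu> d u v w $$ m * (fps_to_fls (g_eps \<epsilon>) powi m) $$ c)"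
    using fls_compose_fps_nth[of "g_eps \<epsilon>" 1] by simp
  also have "\<dots> = \<mu> (Sum_any ?t)"
    by (simp only: functional_Sum_any[OF \<mu> fin] functional_scale[OF \<mu>] iter_line_nth[OF \<mu>] mult.commute)
  finally show ?thesis by (simp only: fsubst_f_eps)
qed

lemma fsubst_f_eps_low:
  obtains N where "\<And>c. c < N \<Longrightarrow> fsubst sW (\<lambda>m. ser2 (f_eps \<epsilon> powi m)) (Yiter Y YW u v w) (c, d) = 0"
proof -
  obtain N where N: "\<And>n. n < N \<Longrightarrow> Y u v n = 0" using Y_low[of u v] by blast
  have "sW ((fps_to_fls (g_eps \<epsilon>) powi m) $$ c) (YW (Y u v m) w (d + m * (\<epsilon> - 1))) = 0" if "c < N" for c m
  proof (cases "m < N")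
    case False
    hence "c < m" using that by simp
    thus ?thesis by (simp add: g_eps_powi_low)
  qed (simp add: N)
  thus ?thesis using that[of N] unfolding fsubst_f_eps by (metis (no_types, lifting) Sum_any.neutral Sum_any.cong)
qed

lemma functional_jacobi_rhs:
  assumes \<mu>: "functional sW \<mu>"
  shows "\<mu> (fmul sW delta_iter (embz2 (fsubst sW (\<lambda>m. ser2 (f_eps \<epsilon> powi m)) (Yiter Y YW u v w))) (a, b, c))
    = ((1 + fls_X) powi (- a - 1) * fls_compose_fps (iter_line \<mu> (a + b + 1) u v w) (g_eps \<epsilon>)) $$ c"
proof -
  let ?H = "fsubst sW (\<lambda>m. ser2 (f_eps \<epsilon> powi m)) (Yiter Y YW u v w)"
  let ?L = "(1 + fls_X) powi (- a - 1) :: complex fls"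
  obtain N where N: "\<And>c. c < N \<Longrightarrow> ?H (c, a + b + 1) = 0" using fsubst_f_eps_low by blast
  have fin: "finite {i. sW (?L $$ i) (?H (c - i, a + b + 1)) \<noteq> 0}"
    by (rule finite_support_int[of 0 _ "c - N"]) (simp_all add: N one_plus_X_powi_nth)
  show ?thesis
    by (simp only: fmul_delta_iter[OF W.vector_space_axioms] functional_Sum_any[OF \<mu> fin]
        functional_scale[OF \<mu>] functional_fsubst_f_eps[OF \<mu>] fls_times_Sum_any)
qed

lemma jacobi_identity:
  "fmul sW delta_12 (emb12 (Yprod YW u v w)) i
      - fmul sW delta_21 (emb12 (Yprod YW v u w \<circ> prod.swap)) i
    = fmul sW delta_iter (embz2 (fsubst sW (\<lambda>m. ser2 (f_eps \<epsilon> powi m)) (Yiter Y YW u v w))) i"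
proof -
  obtain a b c where i: "i = (a, b, c)" by (cases i)
  note vs = W.vector_space_axioms
  show ?thesis
    unfolding i
  proof (rule eq_if_functionals_eq[OF vs])
    fix \<mu> assume \<mu>: "functional sW \<mu>"
    have "a + (b - c) - (- c - 1) = a + b + 1" "b - c + a - (- c - 1) = a + b + 1"
      "a + b + 1 - a + (- c - 1) = b - c" "- (- c - 1) - 1 = c" by simp_all
    thus "\<mu> (fmul sW delta_12 (emb12 (Yprod YW u v w)) (a, b, c)
          - fmul sW delta_21 (emb12 (Yprod YW v u w \<circ> prod.swap)) (a, b, c))
        = \<mu> (fmul sW delta_iter (embz2 (fsubst sW (\<lambda>m. ser2 (f_eps \<epsilon> powi m)) (Yiter Y YW u v w))) (a, b, c))"
      using jacobi_coefficient[OF \<mu>, of "- c - 1" "a + b + 1" u v w a]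
      by (simp only: functional_diff[OF \<mu>] fmul_delta_12[OF vs] fmul_delta_21[OF vs]
          functional_scale[OF \<mu>] fmul_binom_pow_Yprod[OF \<mu>] functional_jacobi_rhs[OF \<mu>])
  qed
qed

lemma commutator_formula:
  "Yprod YW u v w i - (Yprod YW v u w \<circ> prod.swap) i
    = Sum_any (\<lambda>j::nat. sW (1 / fact j)
        (fmul sW ((x2pow_deriv \<epsilon> ^^ j) (delta_comm \<epsilon>)) (emb2 (YW (mode Y u (int j) v) w)) i))"
proof -
  obtain a b where i: "i = (a, b)" by (cases i)
  note vs = W.vector_space_axioms
  let ?d = "a + b" and ?r = "\<epsilon> - 1"
  let ?c = "\<lambda>j. (\<Prod>i<j. of_int (?r - a) + of_nat i * of_int ?r) / fact j :: complex"
  let ?t = "\<lambda>j::nat. sW (?c j) (YW (Y u v (- int j - 1)) w (?d + (- int j - 1) * ?r))"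
  have t: "sW (1 / fact j) (fmul sW ((x2pow_deriv \<epsilon> ^^ j) (delta_comm \<epsilon>)) (emb2 (YW (mode Y u (int j) v) w)) (a, b)) = ?t j" for j
  proof -
    have "a + b - (int j + 1) * ?r = ?d + (- int j - 1) * ?r" by (simp add: algebra_simps)
    thus ?thesis by (simp only: fmul_delta_comm_deriv[OF vs] W.scale_scale mode_def) simp
  qed
  obtain N where N: "\<And>n. n < N \<Longrightarrow> Y u v n = 0" using Y_low[of u v] by blast
  have fin: "finite {j. ?t j \<noteq> 0}"
  proof (rule finite_subset)
    show "{j. ?t j \<noteq> 0} \<subseteq> {..nat (- N - 1)}"
    proof
      fix j assume "j \<in> {j. ?t j \<noteq> 0}"
      hence "\<not> - int j - 1 < N" using N by auto
      thus "j \<in> {..nat (- N - 1)}" by auto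
    qed
  qed simp
  have "Yprod YW u v w (a, b) - (Yprod YW v u w \<circ> prod.swap) (a, b) = Sum_any ?t"
  proof (rule eq_if_functionals_eq[OF vs])
    fix \<mu> assume \<mu>: "functional sW \<mu>"
    let ?L = "(1 + fls_X) powi (- a - 1) :: complex fls" and ?g = "fps_to_fls (g_eps \<epsilon>)"
    let ?q = "iter_line \<mu> ?d u v w"
    have "\<mu> (Yprod YW u v w (a, b) - (Yprod YW v u w \<circ> prod.swap) (a, b))
        = prod_line \<mu> ?d u v w $$ b - prod_line \<mu> ?d v u w $$ a"
      by (simp add: functional_diff[OF \<mu>] Yprod_def prod_line_nth[OF \<mu>])
    also have "\<dots> = (?L * fls_compose_fps ?q (g_eps \<epsilon>)) $$ (-1)"
      using jacobi_coefficient[OF \<mu>, of 0 ?d u v w a] by simp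
    also have "\<dots> = Sum_any (\<lambda>m. ?q $$ m * (?L * ?g powi m) $$ (-1))"
      by (rule fls_compose_fps_nth) simp_all
    also have "\<dots> = Sum_any (\<lambda>j::nat. ?q $$ (- int j - 1) * (?L * ?g powi (- int j - 1)) $$ (-1))"
    proof (rule Sum_any_reindex)
      show "inj (\<lambda>j::nat. - int j - 1)" by (auto simp: inj_def)
      fix m assume m: "m \<notin> range (\<lambda>j::nat. - int j - 1)"
      have "m \<ge> 0"
      proof (rule ccontr)
        assume "\<not> m \<ge> 0"
        hence "m = - int (nat (- m - 1)) - 1" by simp
        thus False using m by blast
      qed
      \<comment> \<open>For nonnegative \<open>m\<close> both factors are power series and the index
        set is empty, so only the modes \<open>u\<^sub>j v\<close> with j nonnegative
        contribute.\<close>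
      have "(?L * ?g powi m) $$ (-1) = (\<Sum>i\<in>{0..-1 - 0}. ?L $$ i * (?g powi m) $$ (- 1 - i))"
        using \<open>m \<ge> 0\<close> by (intro fls_times_nth_sum) (simp_all add: one_plus_X_powi_nth g_eps_powi_low)
      thus "?q $$ m * (?L * ?g powi m) $$ (-1) = 0" by simp
    qed
    also have "\<dots> = Sum_any (\<lambda>j. ?c j * \<mu> (YW (Y u v (- int j - 1)) w (?d + (- int j - 1) * ?r)))"
      by (simp only: residue_g_eps iter_line_nth[OF \<mu>] mult.commute)
    also have "\<dots> = \<mu> (Sum_any ?t)"
      by (simp only: functional_Sum_any[OF \<mu> fin] functional_scale[OF \<mu>])
    finally show "\<mu> (Yprod YW u v w (a, b) - (Yprod YW v u w \<circ> prod.swap) (a, b)) = \<mu> (Sum_any ?t)" .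
  qed
  thus ?thesis by (simp only: i t)
qed

end

theorem theorem3p19:
  fixes \<epsilon> :: int
    and sV :: "complex \<Rightarrow> 'v \<Rightarrow> 'v::ab_group_add"
    and Y :: "'v \<Rightarrow> 'v \<Rightarrow> int \<Rightarrow> 'v"
    and vac :: 'v
    and sW :: "complex \<Rightarrow> 'w \<Rightarrow> 'w::ab_group_add"
    and YW :: "'v \<Rightarrow> 'w \<Rightarrow> int \<Rightarrow> 'w"
  assumes "vertex_algebra sV Y vac"
    and "phi_coordinated_module \<epsilon> sV Y vac sW YW"
  shows "(\<forall>u v w.
      (\<lambda>i. fmul sW delta_12 (emb12 (Yprod YW u v w)) i
         - fmul sW delta_21 (emb12 (Yprod YW v u w \<circ> prod.swap)) i)
      = fmul sW delta_iter
          (embz2 (fsubst sW (\<lambda>m. ser2 (f_eps \<epsilon> powi m)) (Yiter Y YW u v w)))) \<and>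
    (\<forall>u v w.
      (\<lambda>i. Yprod YW u v w i - (Yprod YW v u w \<circ> prod.swap) i)
      = (\<lambda>i. Sum_any (\<lambda>j::nat. sW (1 / fact j)
          (fmul sW ((x2pow_deriv \<epsilon> ^^ j) (delta_comm \<epsilon>))
            (emb2 (YW (mode Y u (int j) v) w)) i))))"
proof -
  interpret phi_coordinated_module \<epsilon> sV Y vac sW YW by fact
  show ?thesis by (intro conjI allI ext jacobi_identity commutator_formula)
qed

end
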